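(* Let $\Xi$ be a simple stationary Poisson cylinder process in $\mathbb{R}^d$ with $k$-dimensional direction spaces, intensity $\lambda$ and shape distribution $\theta$, with union set $U_\Xi=\bigcup_{Z\in\Xi}Z$ and volume fraction $p=\mathbf{P}(\mathbf{o}\in U_\Xi)\in(0,1)$. Let $B\subset\mathbb{R}^d$ be a compact set with $\mathbf{o}\in B$. Then for every $r>0$ the contact distribution function $H_B(r)=\mathbf{P}(U_\Xi\cap rB\ne\emptyset\mid\mathbf{o}\notin U_\Xi)$ is $$H_B(r)=1-\exp\left\{-\lambda\int_{\mathcal{Z}_k^o}\Bigl[\nu_{d-k}^{L(Z)}\bigl(-K(Z)\oplus\pi_{L(Z)}(rB)\bigr)-A(Z)\Bigr]\theta(\mathrm{d}Z)\right\}.$$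
   Context: Let $0\le k\le d-1$ and let $G(k,d)$ be the Grassmannian of $k$-dimensional linear subspaces of $\mathbb{R}^d$. Let $\mathcal{R}$ be the convex ring, i.e. the family of finite unions of non-empty compact convex sets in $\mathbb{R}^d$ (Borel $\sigma$-algebra of the Hausdorff metric). A cylinder is a set $Z=K\oplus\xi$ (Minkowski sum) with direction space $\xi\in G(k,d)$ and base (cross-section) $K\in\mathcal{R}$, $K\subset\xi^\perp$; write $L(Z)=\xi$, $K(Z)=K$. $\mathcal{Z}_k$ is the set of all such cylinders, and $\mathcal{Z}_k^o\subset\mathcal{Z}_k$ is the set of those for which the midpoint of the circumsphere of $K(Z)$ is the origin $\mathbf{o}$. $\nu_{d-k}^{\xi}$ is $(d-k)$-dimensional Lebesgue measure on $\xi^\perp$, $A(Z)=\nu_{d-k}^{L(Z)}(K(Z))$, $\pi_\xi$ is the orthogonal projection along $\xi$ onto $\xi^\perp$, and $-K=\{-x:x\in K\}$. A measure on $\mathcal{Z}_k$ is locally finite if for every compact $C\subset\mathbb{R}^d$ the set of cylinders hitting $C$ has finite measure. A Poisson cylinder process $\Xi$ is a Poisson point process on $\mathcal{Z}_k$ with locally finite intensity measure $\Lambda$; it is simple if it has no multiple points (equivalently $\Lambda$ is diffuse). It is stationary if its distribution is invariant under translations of $\mathbb{R}^d$. In that case there are $\lambda\ge 0$ (the intensity) and a probability measure $\theta$ on $\mathcal{Z}_k^o$ (the shape distribution) such that, for every measurable $f\ge 0$, $$\int_{\mathcal{Z}_k}f\,\mathrm{d}\Lambda=\lambda\int_{\mathcal{Z}_k^o}\int_{L(Z)^\perp}f(\mathbf{x}+Z)\,\nu_{d-k}^{L(Z)}(\mathrm{d}\mathbf{x})\,\theta(\mathrm{d}Z).$$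 Here $Z\in\Xi$ means that $Z$ lies in the support of $\Xi$; $U_\Xi$ is a random closed set. *)

theory Defs
  imports "HOL-Probability.Probability"
begin

section \<open>Lebesgue measure on linear subspaces, orthogonal projection\<close>

definition orthonormal_basis_of :: "'a::euclidean_space set \<Rightarrow> 'a set" where
  "orthonormal_basis_of V =
     (SOME B. B \<subseteq> V \<and> pairwise orthogonal B \<and> (\<forall>b\<in>B. norm b = 1) \<and> span B = V)"

text \<open>The \<open>dim V\<close>-dimensional Lebesgue measure on the linear subspace \<open>V\<close>, regarded as a Borel
  measure on the ambient space that is concentrated on \<open>V\<close>.  The construction is that of
  \<^const>\<open>lborel\<close>, with an orthonormal basis of \<open>V\<close> in place of \<^const>\<open>Basis\<close>; the result does
  not depend on the choice of that basis.\<close>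

definition subspace_lborel :: "'a::euclidean_space set \<Rightarrow> 'a measure" where
  "subspace_lborel V =
     distr (\<Pi>\<^sub>M b\<in>orthonormal_basis_of V. lborel) borel
       (\<lambda>f. \<Sum>b\<in>orthonormal_basis_of V. f b *\<^sub>R b)"

definition proj_along :: "'a::euclidean_space set \<Rightarrow> 'a \<Rightarrow> 'a" where
  "proj_along \<xi> x = (THE y. y \<in> \<xi>\<^sup>\<bottom> \<and> x - y \<in> \<xi>)"


section \<open>The convex ring with the Hausdorff metric\<close>

definition convex_ring :: "'a::euclidean_space set set" where
  "convex_ring = {\<Union>F | F. finite F \<and> F \<noteq> {} \<and> (\<forall>C\<in>F. C \<noteq> {} \<and> compact C \<and> convex C)}"

text \<open>The detour through \<^typ>\<open>ennreal\<close> keeps the value nonnegative for arbitrary arguments, as the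
  locale \<^locale>\<open>Metric_space\<close> demands; for bounded non-empty sets it changes nothing.\<close>

definition hausdorff_dist :: "'a::metric_space set \<Rightarrow> 'a set \<Rightarrow> real" where
  "hausdorff_dist A B =
     enn2real (max (SUP x\<in>A. ennreal (infdist x B)) (SUP y\<in>B. ennreal (infdist y A)))"

definition convex_ring_borel :: "'a::euclidean_space set measure" where
  "convex_ring_borel =
     sigma convex_ring {U. openin (Metric_space.mtopology convex_ring hausdorff_dist) U}"

lemma convex_ring_compact:
  assumes "K \<in> convex_ring"
  shows "compact K" "K \<noteq> {}"
  using assms unfolding convex_ring_def by (auto intro!: compact_Union)

lemma hausdorff_dist_le_iff:
  assumes A: "compact A" "A \<noteq> {}" and B: "compact B" "B \<noteq> {}" and e: "0 \<le> e"
  shows "hausdorff_dist A B \<le> e \<longleftrightarrow> (\<forall>x\<in>A. infdist x B \<le> e) \<and> (\<forall>y\<in>B. infdist y A \<le> e)"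
proof -
  define S where "S = max (SUP x\<in>A. ennreal (infdist x B)) (SUP y\<in>B. ennreal (infdist y A))"
  have *: "S \<le> ennreal c \<longleftrightarrow> (\<forall>x\<in>A. infdist x B \<le> c) \<and> (\<forall>y\<in>B. infdist y A \<le> c)"
    if "0 \<le> c" for c
    using that by (auto simp: S_def SUP_le_iff ennreal_le_iff)
  have bd: "\<exists>c\<ge>0. \<forall>x\<in>X. infdist x Y \<le> c" if X: "compact X" "X \<noteq> {}" for X Y :: "'a set"
  proof -
    have "compact ((\<lambda>x. infdist x Y) ` X)"
      by (intro compact_continuous_image X continuous_on_infdist continuous_on_id)
    then have "bdd_above ((\<lambda>x. infdist x Y) ` X)"
      by (intro bounded_imp_bdd_above compact_imp_bounded)
    then obtain c where "\<forall>x\<in>X. infdist x Y \<le> c"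
      by (auto simp: bdd_above_def)
    then show ?thesis
      using X(2) by (intro exI[of _ c]) (meson all_not_in_conv infdist_nonneg order_trans)
  qed
  obtain c1 c2 where c: "c1 \<ge> 0" "c2 \<ge> 0" "\<forall>x\<in>A. infdist x B \<le> c1" "\<forall>y\<in>B. infdist y A \<le> c2"
    using bd[OF A, of B] bd[OF B, of A] by blast
  have "S \<le> ennreal (max c1 c2)"
    by (subst *) (use c in \<open>auto simp: le_max_iff_disj\<close>)
  then have "S < top"
    by (rule le_less_trans) simp
  then have "enn2real S \<le> e \<longleftrightarrow> S \<le> ennreal e"
    using e by (cases S) auto
  then show ?thesis
    using *[OF e] by (simp add: hausdorff_dist_def S_def)
qed

lemma Metric_space_convex_ring: "Metric_space (convex_ring :: 'a::euclidean_space set set) hausdorff_dist"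
proof
  fix A B :: "'a set"
  show nn: "0 \<le> hausdorff_dist A B"
    by (simp add: hausdorff_dist_def)
  show "hausdorff_dist A B = hausdorff_dist B A"
    by (simp add: hausdorff_dist_def max.commute)
  assume AB: "A \<in> convex_ring" "B \<in> convex_ring"
  note cA = convex_ring_compact[OF AB(1)] and cB = convex_ring_compact[OF AB(2)]
  have "hausdorff_dist A B = 0 \<longleftrightarrow> hausdorff_dist A B \<le> 0"
    using nn by linarith
  also have "\<dots> \<longleftrightarrow> (\<forall>x\<in>A. infdist x B = 0) \<and> (\<forall>y\<in>B. infdist y A = 0)"
    by (subst hausdorff_dist_le_iff[OF cA cB order_refl]) (simp add: order_antisym_conv infdist_nonneg)
  also have "\<dots> \<longleftrightarrow> A = B"
    using cA cB by (auto simp flip: in_closed_iff_infdist_zero simp: compact_imp_closed)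
  finally show "hausdorff_dist A B = 0 \<longleftrightarrow> A = B" .
next
  fix A B C :: "'a set"
  assume ABC: "A \<in> convex_ring" "B \<in> convex_ring" "C \<in> convex_ring"
  note cA = convex_ring_compact[OF ABC(1)] and cB = convex_ring_compact[OF ABC(2)]
    and cC = convex_ring_compact[OF ABC(3)]
  have nn: "0 \<le> hausdorff_dist X Y" for X Y :: "'a set"
    by (simp add: hausdorff_dist_def)
  have tri: "infdist x Z \<le> hausdorff_dist X Y + hausdorff_dist Y Z"
    if X: "compact X" "X \<noteq> {}" and Y: "compact Y" "Y \<noteq> {}" and Z: "compact Z" "Z \<noteq> {}"
      and x: "x \<in> X" for X Y Z :: "'a set" and x
  proof -
    obtain y where y: "y \<in> Y" "infdist x Y = dist x y"
      using infdist_attains_inf[of Y x] Y compact_imp_closed by auto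
    have "infdist x Z \<le> infdist y Z + dist x y"
      by (rule infdist_triangle)
    also have "\<dots> \<le> hausdorff_dist Y Z + hausdorff_dist X Y"
      using hausdorff_dist_le_iff[OF X Y nn, of X Y] hausdorff_dist_le_iff[OF Y Z nn, of Y Z] x y
      by fastforce
    finally show ?thesis by simp
  qed
  have comm: "hausdorff_dist X Y = hausdorff_dist Y X" for X Y :: "'a set"
    by (simp add: hausdorff_dist_def max.commute)
  show "hausdorff_dist A C \<le> hausdorff_dist A B + hausdorff_dist B C"
    using tri[OF cA cB cC] tri[OF cC cB cA] nn[of A B] nn[of B C]
    by (subst hausdorff_dist_le_iff[OF cA cC]) (auto simp: comm add.commute)
qed


section \<open>Cylinders\<close>

definition grassmannian :: "nat \<Rightarrow> 'a::euclidean_space set set" where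
  "grassmannian k = {\<xi>. subspace \<xi> \<and> dim \<xi> = k}"

definition cylinders :: "nat \<Rightarrow> 'a::euclidean_space set set" where
  "cylinders k = {K + \<xi> | K \<xi>. \<xi> \<in> grassmannian k \<and> K \<in> convex_ring \<and> K \<subseteq> \<xi>\<^sup>\<bottom>}"

definition direction :: "'a::euclidean_space set \<Rightarrow> 'a set" where
  "direction Z = (THE \<xi>. subspace \<xi> \<and> (\<exists>K\<in>convex_ring. K \<subseteq> \<xi>\<^sup>\<bottom> \<and> Z = K + \<xi>))"

definition base :: "'a::euclidean_space set \<Rightarrow> 'a set" where
  "base Z = (THE K. K \<in> convex_ring \<and> K \<subseteq> (direction Z)\<^sup>\<bottom> \<and> Z = K + direction Z)"

lemma direction_subset:
  fixes \<xi> \<eta> :: "'a::euclidean_space set"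
  assumes "subspace \<xi>" "K \<in> convex_ring" "subspace \<eta>" "J \<in> convex_ring" "J \<subseteq> \<eta>\<^sup>\<bottom>"
    and eq: "K + \<xi> = J + \<eta>"
  shows "\<xi> \<subseteq> \<eta>"
proof
  fix v assume v: "v \<in> \<xi>"
  obtain x where x: "x \<in> K"
    using convex_ring_compact[OF assms(2)] by auto
  have "v \<bullet> w = 0" if w: "w \<in> \<eta>\<^sup>\<bottom>" for w
  proof (rule ccontr)
    assume nz: "v \<bullet> w \<noteq> 0"
    have "bounded ((\<lambda>j. j \<bullet> w) ` J)"
      by (intro compact_imp_bounded compact_continuous_image continuous_intros
          convex_ring_compact assms(4))
    then obtain c where c: "\<And>j. j \<in> J \<Longrightarrow> \<bar>j \<bullet> w\<bar> \<le> c"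
      by (auto simp: bounded_iff)
    have *: "\<bar>x \<bullet> w + t * (v \<bullet> w)\<bar> \<le> c" for t
    proof -
      have "x + t *\<^sub>R v \<in> J + \<eta>"
        using x v assms(1) by (auto simp flip: eq intro!: set_plus_intro subspace_scale)
      then obtain j u where "j \<in> J" "u \<in> \<eta>" "x + t *\<^sub>R v = j + u"
        by (auto elim: set_plus_elim)
      moreover have "u \<bullet> w = 0"
        using w \<open>u \<in> \<eta>\<close> by (auto simp: orthogonal_comp_def orthogonal_def)
      ultimately show ?thesis
        using c[of j] by (metis add.right_neutral inner_add_left inner_scaleR_left)
    qed
    show False
      using *[of "(c + 1 - x \<bullet> w) / (v \<bullet> w)"] nz by simp
  qed
  then have "v \<in> \<eta>\<^sup>\<bottom>\<^sup>\<bottom>"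
    by (auto simp: orthogonal_comp_def orthogonal_def inner_commute)
  then show "v \<in> \<eta>"
    using orthogonal_comp_self[OF assms(3)] by simp
qed

lemma direction_eq:
  assumes "subspace \<xi>" "K \<in> convex_ring" "K \<subseteq> \<xi>\<^sup>\<bottom>"
  shows "direction (K + \<xi>) = \<xi>"
  unfolding direction_def
  by (rule the_equality) (use assms direction_subset in \<open>blast+\<close>)

lemma base_subset:
  fixes \<xi> :: "'a::euclidean_space set"
  assumes "subspace \<xi>" "K \<subseteq> \<xi>\<^sup>\<bottom>" "J \<subseteq> \<xi>\<^sup>\<bottom>" "K + \<xi> = J + \<xi>"
  shows "K \<subseteq> J"
proof
  fix x assume x: "x \<in> K"
  then have "x + 0 \<in> J + \<xi>"
    using assms by (metis set_plus_intro subspace_0)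
  then obtain j u where ju: "j \<in> J" "u \<in> \<xi>" "x = j + u"
    by (auto elim: set_plus_elim)
  then have "u \<in> \<xi>\<^sup>\<bottom>"
    using x assms(2,3) subspace_diff[OF subspace_orthogonal_comp, of x \<xi> j] by auto
  then have "u = 0"
    using ju by (auto simp: orthogonal_comp_def orthogonal_def)
  then show "x \<in> J"
    using ju by simp
qed

lemma base_eq:
  assumes "subspace \<xi>" "K \<in> convex_ring" "K \<subseteq> \<xi>\<^sup>\<bottom>"
  shows "base (K + \<xi>) = K"
  unfolding base_def direction_eq[OF assms]
  by (rule the_equality) (use assms base_subset[OF assms(1)] in \<open>blast+\<close>)

text \<open>A cylinder corresponds to the pair of its direction space and its base.  The Grassmannian
  carries its usual topology, that of the Hausdorff distance of the sets \<open>\<xi> \<inter> cball 0 1\<close>.\<close>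

definition cylinder_space :: "nat \<Rightarrow> 'a::euclidean_space set measure" where
  "cylinder_space k =
     vimage_algebra (cylinders k) (\<lambda>Z. (direction Z \<inter> cball 0 1, base Z))
       (convex_ring_borel \<Otimes>\<^sub>M convex_ring_borel)"

definition circumsphere_centre :: "'a::euclidean_space set \<Rightarrow> 'a \<Rightarrow> bool" where
  "circumsphere_centre K c \<longleftrightarrow>
     (\<exists>r. K \<subseteq> cball c r \<and> (\<forall>c' r'. K \<subseteq> cball c' r' \<longrightarrow> r \<le> r'))"

definition centred_cylinders :: "nat \<Rightarrow> 'a::euclidean_space set set" where
  "centred_cylinders k = {Z \<in> cylinders k. circumsphere_centre (base Z) 0}"

definition cross_section_volume :: "'a::euclidean_space set \<Rightarrow> real" where
  "cross_section_volume Z = measure (subspace_lborel ((direction Z)\<^sup>\<bottom>)) (base Z)"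

definition hitting :: "nat \<Rightarrow> 'a::euclidean_space set \<Rightarrow> 'a set set" where
  "hitting k C = {Z \<in> cylinders k. Z \<inter> C \<noteq> {}}"

definition locally_finite :: "nat \<Rightarrow> 'a::euclidean_space set measure \<Rightarrow> bool" where
  "locally_finite k N \<longleftrightarrow> (\<forall>C. compact C \<longrightarrow> emeasure N (hitting k C) < \<infinity>)"


section \<open>Poisson cylinder processes\<close>

text \<open>Locally finite counting measures; \<open>m Z\<close> is the multiplicity of the point \<open>Z\<close>.\<close>

definition configurations :: "nat \<Rightarrow> 'a::euclidean_space set measure set" where
  "configurations k =
     {N. sets N = sets (cylinder_space k) \<and> locally_finite k N \<and>
         (\<exists>m :: 'a set \<Rightarrow> nat. \<forall>A\<in>sets (cylinder_space k).
            emeasure N A = (\<integral>\<^sup>+ Z. of_nat (m Z) \<partial>count_space A))}"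

definition configuration_space :: "nat \<Rightarrow> 'a::euclidean_space set measure measure" where
  "configuration_space k =
     sigma (configurations k)
       {{N \<in> configurations k. emeasure N A \<in> S} | A S. A \<in> sets (cylinder_space k) \<and> S \<in> sets borel}"

definition poisson_cylinder_process ::
    "nat \<Rightarrow> 'w measure \<Rightarrow> 'a::euclidean_space set measure \<Rightarrow> ('w \<Rightarrow> 'a set measure) \<Rightarrow> bool" where
  "poisson_cylinder_process k M \<Lambda> \<Xi> \<longleftrightarrow>
     prob_space M \<and>
     sets \<Lambda> = sets (cylinder_space k) \<and> locally_finite k \<Lambda> \<and>
     \<Xi> \<in> M \<rightarrow>\<^sub>M configuration_space k \<and>
     (\<forall>A\<in>sets (cylinder_space k).
        if emeasure \<Lambda> A < \<infinity>
        then \<forall>n. \<P>(\<omega> in M. emeasure (\<Xi> \<omega>) A = of_nat n) = measure \<Lambda> A ^ n / fact n * exp (- measure \<Lambda> A)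
        else AE \<omega> in M. emeasure (\<Xi> \<omega>) A = \<infinity>) \<and>
     (\<forall>(n::nat) A. disjoint_family_on A {..<n} \<and> A ` {..<n} \<subseteq> sets (cylinder_space k) \<longrightarrow>
        prob_space.indep_vars M (\<lambda>_. borel) (\<lambda>i \<omega>. emeasure (\<Xi> \<omega>) (A i)) {..<n})"

definition simple_process :: "'w measure \<Rightarrow> ('w \<Rightarrow> 'a::euclidean_space set measure) \<Rightarrow> bool" where
  "simple_process M \<Xi> \<longleftrightarrow> (AE \<omega> in M. \<forall>Z. emeasure (\<Xi> \<omega>) {Z} \<le> 1)"

definition translate_configuration ::
    "'a::euclidean_space \<Rightarrow> 'a set measure \<Rightarrow> 'a set measure" where
  "translate_configuration x N = distr N N (\<lambda>Z. (+) x ` Z)"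

definition stationary_process ::
    "nat \<Rightarrow> 'w measure \<Rightarrow> ('w \<Rightarrow> 'a::euclidean_space set measure) \<Rightarrow> bool" where
  "stationary_process k M \<Xi> \<longleftrightarrow>
     (\<forall>x. distr M (configuration_space k) (\<lambda>\<omega>. translate_configuration x (\<Xi> \<omega>)) =
          distr M (configuration_space k) \<Xi>)"

definition intensity_and_shape ::
    "nat \<Rightarrow> 'a::euclidean_space set measure \<Rightarrow> real \<Rightarrow> 'a set measure \<Rightarrow> bool" where
  "intensity_and_shape k \<Lambda> \<gamma> \<theta> \<longleftrightarrow>
     0 \<le> \<gamma> \<and> prob_space \<theta> \<and>
     sets \<theta> = sets (restrict_space (cylinder_space k) (centred_cylinders k)) \<and>
     (\<forall>f :: 'a set \<Rightarrow> ennreal. f \<in> borel_measurable (cylinder_space k) \<longrightarrow>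
        (\<integral>\<^sup>+ Z. f Z \<partial>\<Lambda>) =
        ennreal \<gamma> * (\<integral>\<^sup>+ Z. (\<integral>\<^sup>+ x. f ((+) x ` Z) \<partial>subspace_lborel ((direction Z)\<^sup>\<bottom>)) \<partial>\<theta>))"

text \<open>The support of a locally finite counting measure is the set of its atoms.\<close>

definition union_set :: "('w \<Rightarrow> 'a::euclidean_space set measure) \<Rightarrow> 'w \<Rightarrow> 'a set" where
  "union_set \<Xi> \<omega> = \<Union>{Z. emeasure (\<Xi> \<omega>) {Z} > 0}"

definition volume_fraction :: "'w measure \<Rightarrow> ('w \<Rightarrow> 'a::euclidean_space set measure) \<Rightarrow> real" where
  "volume_fraction M \<Xi> = \<P>(\<omega> in M. 0 \<in> union_set \<Xi> \<omega>)"

definition contact_distribution ::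
    "'w measure \<Rightarrow> ('w \<Rightarrow> 'a::euclidean_space set measure) \<Rightarrow> 'a set \<Rightarrow> real \<Rightarrow> real" where
  "contact_distribution M \<Xi> B r =
     \<P>(\<omega> in M. union_set \<Xi> \<omega> \<inter> (*\<^sub>R) r ` B \<noteq> {} \<bar> 0 \<notin> union_set \<Xi> \<omega>)"

end

theory Submission
  imports Defs
begin

text \<open>
  The union set avoids a compact set \<open>C\<close> exactly when no cylinder of the process hits \<open>C\<close>, so the
  Poisson property gives \<open>P(U \<inter> C = {}) = exp (- \<Lambda>(hitting k C))\<close> (\<open>void_probability\<close>).  Because \<open>0 \<in> rB\<close>, the
  event that \<open>U\<close> avoids \<open>rB\<close> is contained in the event that \<open>U\<close> avoids \<open>0\<close>, and the conditional
  probability becomes \<open>1 - exp (- (\<Lambda>(hitting k (rB)) - \<Lambda>(hitting k {0})))\<close>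
  (\<open>contact_distribution_eq\<close>).  For a shift \<open>x\<close> orthogonal to the direction space \<open>\<xi>\<close>, the cylinder \<open>x + Z\<close> hits
  \<open>C\<close> if and only if \<open>x \<in> - K(Z) + \<pi>\<^sub>\<xi>(C)\<close> (\<open>hitting_shifts_eq\<close>).  Inserting the indicator of
  \<open>hitting k C\<close> into the disintegration of \<open>\<Lambda>\<close> therefore turns \<open>\<Lambda>(hitting k C)\<close> into
  \<open>\<gamma> \<integral> \<nu>(- K(Z) + \<pi>\<^sub>\<xi>(C)) \<theta>(dZ)\<close>; for \<open>C = {0}\<close> the integrand is \<open>A(Z)\<close> because
  Lebesgue measure is invariant under reflection.

  Writing the difference of the two values of \<open>\<Lambda>\<close> as a single Bochner integral requires that
  \<open>Z \<mapsto> \<nu>(- K(Z) + \<pi>\<^sub>\<xi>(C))\<close> be measurable.  This is not evident, since the reference measure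
  itself varies with \<open>Z\<close> and is built from an arbitrarily chosen orthonormal basis of \<open>\<xi>\<^sup>\<bottom>\<close>.
  The remedy is to express it by the Lebesgue measure of the whole space.  By Fubini, for
  a function \<open>h\<close> invariant under \<open>\<xi>\<close>, integrating \<open>h\<close> against the Gaussian \<open>exp (- s |y|\<^sup>2)\<close> over the
  whole space gives a constant depending only on \<open>s\<close> and \<open>dim \<xi>\<close> times the corresponding integral
  over \<open>\<xi>\<^sup>\<bottom>\<close>; letting \<open>s\<close> tend to \<open>0\<close> removes the weight
  (\<open>nn_integral_subspace_eq_SUP\<close>).  With \<open>h\<close> the indicator of \<open>{y. (y + Z) \<inter> C \<noteq> {}}\<close>, only the joint
  measurability of \<open>(Z, y) \<mapsto> ((y + Z) \<inter> C \<noteq> {})\<close> remains, and this event can be written with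
  countably many conditions on the distances from points of a countable dense set to
  \<open>\<xi> \<inter> cball 0 1\<close> and to \<open>K(Z)\<close> (\<open>pred_translate_hits\<close>).  These distances are continuous for the
  Hausdorff metric.
\<close>

section \<open>Lebesgue measure in orthonormal coordinates\<close>

definition orthonormal :: "'a::euclidean_space set \<Rightarrow> bool" where
  "orthonormal B \<longleftrightarrow> pairwise orthogonal B \<and> (\<forall>b\<in>B. norm b = 1)"

lemma orthonormal_independent:
  assumes "orthonormal B"
  shows "independent B"
  using assms unfolding orthonormal_def
  by (intro pairwise_orthogonal_independent) fastforce+

lemma orthonormal_finite:
  assumes "orthonormal B"
  shows "finite B"
  using orthonormal_independent[OF assms] by (rule independent_imp_finite)

lemma orthonormal_inner:
  assumes "orthonormal B" "a \<in> B" "b \<in> B"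
  shows "a \<bullet> b = (if a = b then 1 else 0)"
  using assms by (auto simp: orthonormal_def pairwise_def orthogonal_def norm_eq_1)

lemma orthonormal_expansion:
  assumes "orthonormal B" "x \<in> span B"
  shows "(\<Sum>b\<in>B. (x \<bullet> b) *\<^sub>R b) = x"
  using assms(2)
proof (induction rule: span_induct)
  case base
  show ?case
    by (auto simp: subspace_def inner_add_left scaleR_add_left sum.distrib
        simp flip: scaleR_scaleR scaleR_sum_right)
next
  case (step x)
  have "(\<Sum>b\<in>B. (x \<bullet> b) *\<^sub>R b) = (\<Sum>b\<in>B. if b = x then x else 0)"
    using step by (intro sum.cong) (auto simp: orthonormal_inner[OF assms(1)])
  then show ?case
    using step orthonormal_finite[OF assms(1)] by simp
qed

lemma orthonormal_norm_sum:
  assumes "orthonormal B"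
  shows "(norm (\<Sum>b\<in>B. f b *\<^sub>R b))\<^sup>2 = (\<Sum>b\<in>B. (f b)\<^sup>2)"
proof -
  have "(norm (\<Sum>b\<in>B. f b *\<^sub>R b))\<^sup>2 = (\<Sum>a\<in>B. \<Sum>b\<in>B. f a * f b * (b \<bullet> a))"
    by (simp add: power2_norm_eq_inner inner_sum_left inner_sum_right sum_distrib_left mult_ac)
  also have "\<dots> = (\<Sum>a\<in>B. \<Sum>b\<in>B. if a = b then f a * f a else 0)"
    by (intro sum.cong refl) (simp add: orthonormal_inner[OF assms])
  also have "\<dots> = (\<Sum>b\<in>B. (f b)\<^sup>2)"
    using orthonormal_finite[OF assms] by (simp add: power2_eq_square)
  finally show ?thesis .
qed

text \<open>The construction underlying both \<^const>\<open>lborel\<close> and \<^const>\<open>subspace_lborel\<close>, with the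
  orthonormal system as a parameter, so that bases of complementary subspaces can be joined.\<close>
definition basis_lborel :: "'a::euclidean_space set \<Rightarrow> 'a measure" where
  "basis_lborel B = distr (\<Pi>\<^sub>M b\<in>B. lborel) borel (\<lambda>f. \<Sum>b\<in>B. f b *\<^sub>R b)"

lemma sets_basis_lborel [measurable_cong, simp]: "sets (basis_lborel B) = sets borel"
  by (simp add: basis_lborel_def)

lemma nn_integral_basis_lborel:
  assumes [measurable]: "h \<in> borel_measurable borel"
  shows "(\<integral>\<^sup>+x. h x \<partial>basis_lborel B) = (\<integral>\<^sup>+f. h (\<Sum>b\<in>B. f b *\<^sub>R b) \<partial>(\<Pi>\<^sub>M b\<in>B. lborel))"
  unfolding basis_lborel_def by (subst nn_integral_distr) auto

lemma AE_basis_lborel: "AE x in basis_lborel B. x \<in> span B"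
proof -
  have [measurable]: "span B \<in> sets borel"
    by (intro borel_closed closed_subspace subspace_span)
  show ?thesis
    unfolding basis_lborel_def
    by (subst AE_distr_iff) (auto intro!: AE_I2 intro: span_sum span_scale span_base)
qed

text \<open>Serves both for translations and for the reflection at the origin, which act coordinatewise.\<close>
lemma distr_PiM_lborel:
  fixes \<phi> :: "'i \<Rightarrow> real \<Rightarrow> real"
  assumes fin: "finite I" and [measurable]: "\<And>i. i \<in> I \<Longrightarrow> \<phi> i \<in> borel_measurable borel"
    and pres: "\<And>i. i \<in> I \<Longrightarrow> distr lborel borel (\<phi> i) = lborel"
  shows "distr (\<Pi>\<^sub>M i\<in>I. lborel) (\<Pi>\<^sub>M i\<in>I. lborel) (\<lambda>f. \<lambda>i\<in>I. \<phi> i (f i)) = (\<Pi>\<^sub>M i\<in>I. lborel)"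
proof -
  interpret product_sigma_finite "\<lambda>_::'i. lborel :: real measure" ..
  show ?thesis
  proof (rule PiM_eqI[OF fin])
    show "sets (distr (\<Pi>\<^sub>M i\<in>I. lborel) (\<Pi>\<^sub>M i\<in>I. lborel) (\<lambda>f. \<lambda>i\<in>I. \<phi> i (f i)))
        = sets (\<Pi>\<^sub>M i\<in>I. lborel)"
      by simp
    fix A assume "\<And>i. i \<in> I \<Longrightarrow> A i \<in> sets (lborel :: real measure)"
    then have A[measurable]: "\<And>i. i \<in> I \<Longrightarrow> A i \<in> sets borel" by simp
    have pre: "\<phi> i -` A i \<in> sets borel" if "i \<in> I" for i
      using measurable_sets[of "\<phi> i" borel borel "A i"] that by simp
    have "emeasure (distr (\<Pi>\<^sub>M i\<in>I. lborel) (\<Pi>\<^sub>M i\<in>I. lborel) (\<lambda>f. \<lambda>i\<in>I. \<phi> i (f i))) (Pi\<^sub>E I A)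
        = emeasure (\<Pi>\<^sub>M i\<in>I. lborel) (Pi\<^sub>E I (\<lambda>i. \<phi> i -` A i))"
      using A fin
      by (subst emeasure_distr)
        (auto intro!: arg_cong2[where f=emeasure] sets_PiM_I_finite simp: space_PiM PiE_iff)
    also have "\<dots> = (\<Prod>i\<in>I. emeasure lborel (\<phi> i -` A i))"
      using pre by (intro emeasure_PiM fin) auto
    also have "\<dots> = (\<Prod>i\<in>I. emeasure lborel (A i))"
    proof (intro prod.cong refl)
      fix i assume i: "i \<in> I"
      have "emeasure lborel (A i) = emeasure (distr lborel borel (\<phi> i)) (A i)"
        by (simp add: pres i)
      also have "\<dots> = emeasure lborel (\<phi> i -` A i)"
        using i by (subst emeasure_distr) auto
      finally show "emeasure lborel (\<phi> i -` A i) = emeasure lborel (A i)" by simp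
    qed
    finally show "emeasure (distr (\<Pi>\<^sub>M i\<in>I. lborel) (\<Pi>\<^sub>M i\<in>I. lborel) (\<lambda>f. \<lambda>i\<in>I. \<phi> i (f i))) (Pi\<^sub>E I A)
        = (\<Prod>i\<in>I. emeasure lborel (A i))" .
  qed
qed

text \<open>Gaussian weights are the tool for comparing Lebesgue measures: they are products in every
  orthonormal coordinate system, so their integral depends on the number of coordinates alone.\<close>
definition gauss :: "real \<Rightarrow> 'a::euclidean_space \<Rightarrow> ennreal" where
  "gauss s x = ennreal (exp (- s * (norm x)\<^sup>2))"

definition gauss_mass :: "real \<Rightarrow> ennreal" where
  "gauss_mass s = (\<integral>\<^sup>+t. gauss s (t::real) \<partial>lborel)"

lemma gauss_measurable [measurable]: "gauss s \<in> borel_measurable borel"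
  unfolding gauss_def by measurable

lemma gauss_uminus [simp]: "gauss s (- x) = gauss s x"
  by (simp add: gauss_def)

lemma gauss_mass_eq:
  assumes "0 < s"
  shows "gauss_mass s = ennreal (sqrt (pi / s))"
proof -
  define \<sigma> where "\<sigma> = sqrt (1 / (2 * s))"
  have \<sigma>: "0 < \<sigma>" "\<sigma>\<^sup>2 = 1 / (2 * s)"
    using assms by (auto simp: \<sigma>_def)
  interpret N: prob_space "density lborel (normal_density 0 \<sigma>)"
    using \<sigma> by (intro prob_space_normal_density) auto
  have "1 = emeasure (density lborel (normal_density 0 \<sigma>)) UNIV"
    using N.emeasure_space_1 by simp
  also have "\<dots> = (\<integral>\<^sup>+t. ennreal (normal_density 0 \<sigma> t) \<partial>lborel)"
    by (subst emeasure_density) auto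
  finally have 1: "(\<integral>\<^sup>+t. ennreal (normal_density 0 \<sigma> t) \<partial>lborel) = 1" by simp
  have "gauss s t = ennreal (sqrt (pi / s)) * ennreal (normal_density 0 \<sigma> t)" for t :: real
  proof -
    have *: "2 * pi * \<sigma>\<^sup>2 = pi / s" "t\<^sup>2 / (2 * \<sigma>\<^sup>2) = s * t\<^sup>2"
      using assms \<sigma>(2) by simp_all
    show ?thesis
      using assms by (simp add: gauss_def normal_density_def * flip: ennreal_mult')
  qed
  then show ?thesis
    by (simp add: gauss_mass_def nn_integral_cmult 1)
qed

lemma gauss_sum:
  assumes "orthonormal B"
  shows "gauss s (\<Sum>b\<in>B. f b *\<^sub>R b) = (\<Prod>b\<in>B. gauss s (f b))"
  by (simp add: gauss_def orthonormal_norm_sum[OF assms] prod_ennreal sum_distrib_left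
      orthonormal_finite[OF assms] flip: exp_sum)

lemma gauss_add_orthogonal:
  assumes "orthogonal x y"
  shows "gauss s (x + y) = gauss s x * gauss s y"
  using norm_add_Pythagorean[OF assms]
  by (simp add: gauss_def mult_exp_exp algebra_simps flip: ennreal_mult')

lemma nn_integral_gauss_basis:
  assumes "orthonormal B"
  shows "(\<integral>\<^sup>+x. gauss s x \<partial>basis_lborel B) = gauss_mass s ^ card B"
proof -
  interpret product_sigma_finite "\<lambda>_::'a. lborel :: real measure" ..
  have "(\<integral>\<^sup>+x. gauss s x \<partial>basis_lborel B)
      = (\<integral>\<^sup>+f. (\<Prod>b\<in>B. gauss s (f b :: real)) \<partial>(\<Pi>\<^sub>M b\<in>B. lborel))"
    by (simp add: nn_integral_basis_lborel gauss_sum[OF assms])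
  also have "\<dots> = gauss_mass s ^ card B"
    using orthonormal_finite[OF assms]
    by (subst product_nn_integral_prod) (auto simp: gauss_mass_def)
  finally show ?thesis .
qed

lemma orthonormal_Basis: "orthonormal Basis"
  by (auto simp: orthonormal_def pairwise_def orthogonal_def inner_not_same_Basis)

lemma basis_lborel_Basis: "basis_lborel Basis = lborel"
  unfolding basis_lborel_def by (rule lborel_eq[symmetric])

lemma nn_integral_lborel_translate:
  fixes c :: "'a::euclidean_space"
  assumes [measurable]: "h \<in> borel_measurable borel"
  shows "(\<integral>\<^sup>+y. h (c + y) \<partial>lborel) = (\<integral>\<^sup>+y. h y \<partial>lborel)"
proof -
  have "(\<integral>\<^sup>+y. h y \<partial>lborel) = (\<integral>\<^sup>+y. h y \<partial>distr lborel borel ((+) c))"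
    by (simp add: lborel_distr_plus)
  then show ?thesis
    by (simp add: nn_integral_distr)
qed

lemma nn_integral_PiM_lborel_translate:
  assumes B: "orthonormal B" and y: "y \<in> span B" and [measurable]: "h \<in> borel_measurable borel"
  shows "(\<integral>\<^sup>+f. h (y + (\<Sum>b\<in>B. f b *\<^sub>R b)) \<partial>(\<Pi>\<^sub>M b\<in>B. lborel))
    = (\<integral>\<^sup>+f. h (\<Sum>b\<in>B. f b *\<^sub>R b) \<partial>(\<Pi>\<^sub>M b\<in>B. lborel))"
proof -
  let ?Q = "\<Pi>\<^sub>M b\<in>B. lborel :: real measure"
  have "(\<integral>\<^sup>+f. h (\<Sum>b\<in>B. f b *\<^sub>R b) \<partial>?Q)
      = (\<integral>\<^sup>+f. h (\<Sum>b\<in>B. f b *\<^sub>R b) \<partial>distr ?Q ?Q (\<lambda>f. \<lambda>b\<in>B. y \<bullet> b + f b))"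
    by (subst distr_PiM_lborel)
      (auto simp: orthonormal_finite[OF B] lborel_distr_plus)
  also have "\<dots> = (\<integral>\<^sup>+f. h (\<Sum>b\<in>B. (y \<bullet> b + f b) *\<^sub>R b) \<partial>?Q)"
    by (subst nn_integral_distr) auto
  also have "\<dots> = (\<integral>\<^sup>+f. h (y + (\<Sum>b\<in>B. f b *\<^sub>R b)) \<partial>?Q)"
    by (simp add: scaleR_add_left sum.distrib orthonormal_expansion[OF B y])
  finally show ?thesis by simp
qed

text \<open>Rotation invariance of Lebesgue measure, obtained from uniqueness of translation-invariant
  measures.  For \<open>\<mu> = basis_lborel B\<close> and the even weight \<open>g = gauss 1\<close>, the double integral of
  \<open>1\<^sub>A(x) g(y - x)\<close> with respect to \<open>\<mu>(dx) dy\<close> is \<open>\<mu>(A) \<integral> g dy\<close>; translating \<open>x\<close> by \<open>y\<close> first,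
  it is also \<open>\<lambda>(A) \<integral> g d\<mu>\<close>.  The two integrals of \<open>g\<close> agree, being determined by the dimension.
  Fubini is applied on the coordinate space, whose product measure is known to be sigma-finite.\<close>
lemma basis_lborel_eq_lborel:
  fixes B :: "'a::euclidean_space set"
  assumes B: "orthonormal B" and span: "span B = UNIV"
  shows "basis_lborel B = lborel"
proof (rule measure_eqI)
  fix A assume "A \<in> sets (basis_lborel B)"
  then have A[measurable]: "A \<in> sets borel" by simp
  let ?Q = "\<Pi>\<^sub>M b\<in>B. lborel :: real measure"
  define T where "T f = (\<Sum>b\<in>B. f b *\<^sub>R b)" for f
  have [measurable]: "T \<in> borel_measurable ?Q"
    unfolding T_def by measurable
  interpret P: product_sigma_finite "\<lambda>_::'a. lborel :: real measure" ..
  interpret Q: sigma_finite_measure ?Q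
    by (rule P.sigma_finite[OF orthonormal_finite[OF B]])
  interpret pair_sigma_finite ?Q "lborel :: 'a measure" ..
  have nnT: "(\<integral>\<^sup>+f. h (T f) \<partial>?Q) = (\<integral>\<^sup>+x. h x \<partial>basis_lborel B)"
    if "h \<in> borel_measurable borel" for h
    using that by (simp add: T_def nn_integral_basis_lborel)
  define E :: ennreal where "E = gauss_mass 1 ^ DIM('a)"
  have E: "(\<integral>\<^sup>+x. gauss 1 x \<partial>basis_lborel C) = E"
    if "orthonormal C" "span C = UNIV" for C :: "'a set"
    using that nn_integral_gauss_basis[OF that(1), of 1]
      dim_span_eq_card_independent[OF orthonormal_independent[OF that(1)]]
    by (simp add: E_def)
  have E0: "E \<noteq> 0" "E \<noteq> \<infinity>"
    using gauss_mass_eq[of 1] by (auto simp: E_def power_eq_top_ennreal)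
  have El: "(\<integral>\<^sup>+x. gauss 1 x \<partial>(lborel :: 'a measure)) = E"
    using E[OF orthonormal_Basis] by (simp add: basis_lborel_Basis)
  have "(\<integral>\<^sup>+f. (\<integral>\<^sup>+y. indicator A (T f) * gauss 1 (y - T f) \<partial>lborel) \<partial>?Q)
      = (\<integral>\<^sup>+f. indicator A (T f) * E \<partial>?Q)"
    using nn_integral_lborel_translate[of "gauss 1" "- T f" for f]
    by (intro nn_integral_cong) (simp add: nn_integral_cmult El)
  also have "\<dots> = emeasure (basis_lborel B) A * E"
    by (subst nnT) (simp_all add: nn_integral_multc)
  finally have 1: "(\<integral>\<^sup>+f. (\<integral>\<^sup>+y. indicator A (T f) * gauss 1 (y - T f) \<partial>lborel) \<partial>?Q)
      = emeasure (basis_lborel B) A * E" .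
  have "(\<integral>\<^sup>+f. (\<integral>\<^sup>+y. indicator A (T f) * gauss 1 (y - T f) \<partial>lborel) \<partial>?Q)
      = (\<integral>\<^sup>+y. (\<integral>\<^sup>+f. indicator A (T f) * gauss 1 (y - T f) \<partial>?Q) \<partial>lborel)"
    by (rule Fubini'[symmetric]) measurable
  also have "\<dots> = (\<integral>\<^sup>+y. (\<integral>\<^sup>+f. indicator A (y + T f) * gauss 1 (T f) \<partial>?Q) \<partial>lborel)"
  proof (rule nn_integral_cong)
    fix y :: 'a
    show "(\<integral>\<^sup>+f. indicator A (T f) * gauss 1 (y - T f) \<partial>?Q)
        = (\<integral>\<^sup>+f. indicator A (y + T f) * gauss 1 (T f) \<partial>?Q)"
      using nn_integral_PiM_lborel_translate[OF B, of y "\<lambda>x. indicator A x * gauss 1 (y - x)"] span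
      by (simp add: T_def)
  qed
  also have "\<dots> = (\<integral>\<^sup>+f. (\<integral>\<^sup>+y. indicator A (y + T f) * gauss 1 (T f) \<partial>lborel) \<partial>?Q)"
    by (rule Fubini') measurable
  also have "\<dots> = (\<integral>\<^sup>+f. emeasure lborel A * gauss 1 (T f) \<partial>?Q)"
    using nn_integral_lborel_translate[of "indicator A" "T f" for f]
    by (intro nn_integral_cong) (simp add: nn_integral_multc add.commute)
  also have "\<dots> = emeasure lborel A * E"
    by (simp add: nn_integral_cmult nnT E[OF B span])
  finally show "emeasure (basis_lborel B) A = emeasure lborel A"
    using 1 E0 by (metis ennreal_mult_divide_eq infinity_ennreal_def)
qed simp

lemma nn_integral_basis_lborel_Un:
  assumes B: "orthonormal (B \<union> C)" and disj: "B \<inter> C = {}"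
    and [measurable]: "h \<in> borel_measurable borel"
  shows "(\<integral>\<^sup>+x. h x \<partial>basis_lborel (B \<union> C))
    = (\<integral>\<^sup>+x. (\<integral>\<^sup>+y. h (x + y) \<partial>basis_lborel C) \<partial>basis_lborel B)"
proof -
  interpret P: product_sigma_finite "\<lambda>_::'a. lborel :: real measure" ..
  have fin: "finite B" "finite C"
    using orthonormal_finite[OF B] by auto
  interpret Q: sigma_finite_measure "\<Pi>\<^sub>M b\<in>C. lborel :: real measure"
    by (rule P.sigma_finite[OF fin(2)])
  have "(\<integral>\<^sup>+x. h x \<partial>basis_lborel (B \<union> C))
      = (\<integral>\<^sup>+f. (\<integral>\<^sup>+g. h (\<Sum>b\<in>B \<union> C. merge B C (f, g) b *\<^sub>R b) \<partial>(\<Pi>\<^sub>M b\<in>C. lborel)) \<partial>(\<Pi>\<^sub>M b\<in>B. lborel))"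
    by (subst nn_integral_basis_lborel, simp, subst P.product_nn_integral_fold[OF disj fin]) auto
  also have "\<dots> = (\<integral>\<^sup>+f. (\<integral>\<^sup>+g. h ((\<Sum>b\<in>B. f b *\<^sub>R b) + (\<Sum>b\<in>C. g b *\<^sub>R b)) \<partial>(\<Pi>\<^sub>M b\<in>C. lborel)) \<partial>(\<Pi>\<^sub>M b\<in>B. lborel))"
    using disj by (intro nn_integral_cong arg_cong[where f=h])
      (simp add: sum.union_disjoint[OF fin disj])
  also have "\<dots> = (\<integral>\<^sup>+x. (\<integral>\<^sup>+g. h (x + (\<Sum>b\<in>C. g b *\<^sub>R b)) \<partial>(\<Pi>\<^sub>M b\<in>C. lborel)) \<partial>basis_lborel B)"
    by (subst nn_integral_basis_lborel) auto
  also have "\<dots> = (\<integral>\<^sup>+x. (\<integral>\<^sup>+y. h (x + y) \<partial>basis_lborel C) \<partial>basis_lborel B)"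
    by (intro nn_integral_cong, subst nn_integral_basis_lborel) auto
  finally show ?thesis .
qed

section \<open>Lebesgue measure on a subspace\<close>

lemma orthonormal_basis_of:
  assumes "subspace V"
  shows "orthonormal (orthonormal_basis_of V)" "span (orthonormal_basis_of V) = V"
proof -
  obtain B where "B \<subseteq> V" "pairwise orthogonal B" "\<And>x. x \<in> B \<Longrightarrow> norm x = 1" "span B = V"
    using orthonormal_basis_subspace[OF assms] by metis
  then have "\<exists>B. B \<subseteq> V \<and> pairwise orthogonal B \<and> (\<forall>b\<in>B. norm b = 1) \<and> span B = V"
    by blast
  from someI_ex[OF this, folded orthonormal_basis_of_def]
  show "orthonormal (orthonormal_basis_of V)" "span (orthonormal_basis_of V) = V"
    by (auto simp: orthonormal_def)
qed

lemma subspace_lborel_eq: "subspace_lborel V = basis_lborel (orthonormal_basis_of V)"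
  by (simp add: subspace_lborel_def basis_lborel_def)

lemma sets_subspace_lborel [measurable_cong, simp]: "sets (subspace_lborel V) = sets borel"
  by (simp add: subspace_lborel_eq)

lemma AE_subspace_lborel:
  assumes "subspace V"
  shows "AE x in subspace_lborel V. x \<in> V"
  using AE_basis_lborel[of "orthonormal_basis_of V"]
  unfolding orthonormal_basis_of(2)[OF assms] subspace_lborel_eq .

lemma emeasure_subspace_lborel_uminus:
  fixes V :: "'a::euclidean_space set"
  assumes V: "subspace V" and [measurable]: "A \<in> sets borel"
  shows "emeasure (subspace_lborel V) (uminus ` A) = emeasure (subspace_lborel V) A"
proof -
  let ?B = "orthonormal_basis_of V"
  let ?Q = "\<Pi>\<^sub>M b\<in>?B. lborel :: real measure"
  have im: "uminus ` A = uminus -` A"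
    by force
  have [measurable]: "uminus -` A \<in> sets borel"
    using measurable_sets[of uminus borel borel A] by simp
  have "emeasure (subspace_lborel V) A = (\<integral>\<^sup>+f. indicator A (\<Sum>b\<in>?B. f b *\<^sub>R b) \<partial>?Q)"
    by (subst nn_integral_basis_lborel[symmetric]) (auto simp: subspace_lborel_eq)
  also have "\<dots> = (\<integral>\<^sup>+f. indicator A (\<Sum>b\<in>?B. f b *\<^sub>R b) \<partial>distr ?Q ?Q (\<lambda>f. \<lambda>b\<in>?B. - f b))"
    by (subst distr_PiM_lborel)
      (auto simp: orthonormal_finite[OF orthonormal_basis_of(1)[OF V]] lborel_distr_uminus)
  also have "\<dots> = (\<integral>\<^sup>+f. indicator (uminus -` A) (\<Sum>b\<in>?B. f b *\<^sub>R b) \<partial>?Q)"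
    by (subst nn_integral_distr) (auto simp: sum_negf indicator_def)
  also have "\<dots> = emeasure (subspace_lborel V) (uminus -` A)"
    by (subst nn_integral_basis_lborel[symmetric]) (auto simp: subspace_lborel_eq)
  finally show ?thesis by (simp add: im)
qed

text \<open>Decompose the space as \<open>\<xi>\<^sup>\<bottom> + \<xi>\<close>.  The Gaussian factorises along the decomposition, and
  \<open>h\<close> does not see the \<open>\<xi>\<close>-component, whose integral is thus a constant.\<close>
lemma nn_integral_subspace_gauss:
  fixes \<xi> :: "'a::euclidean_space set"
  assumes \<xi>: "subspace \<xi>" and h[measurable]: "h \<in> borel_measurable borel"
    and inv: "\<And>x u. u \<in> \<xi> \<Longrightarrow> h (x + u) = h x"
  shows "(\<integral>\<^sup>+y. h y * gauss s y \<partial>lborel)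
    = gauss_mass s ^ dim \<xi> * (\<integral>\<^sup>+x. h x * gauss s x \<partial>subspace_lborel (\<xi>\<^sup>\<bottom>))"
proof -
  let ?B = "orthonormal_basis_of (\<xi>\<^sup>\<bottom>)" and ?C = "orthonormal_basis_of \<xi>"
  note B = orthonormal_basis_of[OF subspace_orthogonal_comp[of \<xi>]]
  note C = orthonormal_basis_of[OF \<xi>]
  have orth: "orthogonal b c" if "b \<in> \<xi>\<^sup>\<bottom>" "c \<in> \<xi>" for b c
    using that by (auto simp: orthogonal_comp_def orthogonal_commute)
  have Bs: "?B \<subseteq> \<xi>\<^sup>\<bottom>" and Cs: "?C \<subseteq> \<xi>"
    using B(2) C(2) span_superset by metis+
  have BC: "orthonormal (?B \<union> ?C)"
    using B(1) C(1) orth Bs Cs unfolding orthonormal_def pairwise_def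
    by (blast intro: orthogonal_commute[THEN iffD1])
  have disj: "?B \<inter> ?C = {}"
  proof (rule ccontr)
    assume "?B \<inter> ?C \<noteq> {}"
    then obtain b where b: "b \<in> ?B" "b \<in> ?C" by blast
    then have "orthogonal b b" using Bs Cs orth by blast
    then show False using b B(1) by (auto simp: orthonormal_def orthogonal_def)
  qed
  have "x \<in> span (?B \<union> ?C)" for x
  proof -
    have "x \<in> \<xi> + \<xi>\<^sup>\<bottom>"
      using subspace_sum_orthogonal_comp[OF \<xi>] by simp
    then obtain u v where "u \<in> \<xi>" "v \<in> \<xi>\<^sup>\<bottom>" "x = u + v"
      by (auto elim: set_plus_elim)
    then show ?thesis
      using B(2) C(2) span_mono[of ?B "?B \<union> ?C"] span_mono[of ?C "?B \<union> ?C"]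
      by (auto intro!: span_add)
  qed
  then have sp: "span (?B \<union> ?C) = UNIV" by blast
  have "(\<integral>\<^sup>+y. h y * gauss s y \<partial>lborel)
      = (\<integral>\<^sup>+x. (\<integral>\<^sup>+u. h (x + u) * gauss s (x + u) \<partial>basis_lborel ?C) \<partial>basis_lborel ?B)"
    by (subst nn_integral_basis_lborel_Un[OF BC disj, symmetric])
      (auto simp: basis_lborel_eq_lborel[OF BC sp])
  also have "\<dots> = (\<integral>\<^sup>+x. (\<integral>\<^sup>+u. (h x * gauss s x) * gauss s u \<partial>basis_lborel ?C) \<partial>basis_lborel ?B)"
  proof (rule nn_integral_cong_AE, use AE_basis_lborel[of ?B] in eventually_elim)
    fix x assume x: "x \<in> span ?B"
    show "(\<integral>\<^sup>+u. h (x + u) * gauss s (x + u) \<partial>basis_lborel ?C)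
        = (\<integral>\<^sup>+u. (h x * gauss s x) * gauss s u \<partial>basis_lborel ?C)"
    proof (rule nn_integral_cong_AE, use AE_basis_lborel[of ?C] in eventually_elim)
      fix u assume u: "u \<in> span ?C"
      show "h (x + u) * gauss s (x + u) = (h x * gauss s x) * gauss s u"
        using x u by (simp add: B(2) C(2) inv gauss_add_orthogonal orth mult.assoc)
    qed
  qed
  also have "\<dots> = (\<integral>\<^sup>+x. (h x * gauss s x) * gauss_mass s ^ dim \<xi> \<partial>basis_lborel ?B)"
    using dim_span_eq_card_independent[OF orthonormal_independent[OF C(1)]] C(2)
    by (simp add: nn_integral_cmult nn_integral_gauss_basis[OF C(1)])
  finally show ?thesis
    by (simp add: nn_integral_cmult mult.commute subspace_lborel_eq)
qed

text \<open>Only integrals with respect to one fixed measure remain on the right-hand side, so that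
  measurability in \<open>\<xi>\<close> becomes accessible.  The weights increase to \<open>1\<close>, and the convergence is
  monotone.\<close>
lemma nn_integral_subspace_eq_SUP:
  fixes \<xi> :: "'a::euclidean_space set"
  assumes \<xi>: "subspace \<xi>" and h[measurable]: "h \<in> borel_measurable borel"
    and inv: "\<And>x u. u \<in> \<xi> \<Longrightarrow> h (x + u) = h x"
  shows "(\<integral>\<^sup>+x. h x \<partial>subspace_lborel (\<xi>\<^sup>\<bottom>))
    = (SUP n::nat. (\<integral>\<^sup>+y. h y * gauss (1 / Suc n) y \<partial>lborel) / gauss_mass (1 / Suc n) ^ dim \<xi>)"
proof -
  have sup: "(SUP n::nat. gauss (1 / Suc n) x) = 1" for x :: 'a
  proof (rule LIMSEQ_unique[OF LIMSEQ_SUP])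
    show "incseq (\<lambda>n. gauss (1 / Suc n) x)"
      by (auto simp: incseq_def gauss_def intro!: ennreal_leI divide_left_mono)
    have "(\<lambda>n. exp (- (1 / Suc n) * (norm x)\<^sup>2)) \<longlonglongrightarrow> exp (- 0 * (norm x)\<^sup>2)"
      by (intro tendsto_intros LIMSEQ_Suc[OF lim_1_over_n])
    then show "(\<lambda>n. gauss (1 / Suc n) x) \<longlonglongrightarrow> 1"
      unfolding gauss_def by (metis ennreal_1 exp_zero mult_zero_left neg_0_equal_iff_equal tendsto_ennrealI)
  qed
  have "(\<integral>\<^sup>+x. h x \<partial>subspace_lborel (\<xi>\<^sup>\<bottom>))
      = (\<integral>\<^sup>+x. (SUP n::nat. h x * gauss (1 / Suc n) x) \<partial>subspace_lborel (\<xi>\<^sup>\<bottom>))"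
    by (simp only: sup mult_1_right flip: SUP_mult_left_ennreal)
  also have "\<dots> = (SUP n::nat. \<integral>\<^sup>+x. h x * gauss (1 / Suc n) x \<partial>subspace_lborel (\<xi>\<^sup>\<bottom>))"
    by (intro nn_integral_monotone_convergence_SUP)
      (auto simp: incseq_def gauss_def le_fun_def intro!: mult_left_mono ennreal_leI divide_left_mono)
  also have "\<dots> = (SUP n::nat. (\<integral>\<^sup>+y. h y * gauss (1 / Suc n) y \<partial>lborel) / gauss_mass (1 / Suc n) ^ dim \<xi>)"
  proof (intro SUP_cong refl)
    fix n :: nat
    define c where "c = gauss_mass (1 / Suc n) ^ dim \<xi>"
    have "c \<noteq> 0" "c \<noteq> top"
      unfolding c_def using gauss_mass_eq[of "1 / Suc n"] by (auto simp: power_eq_top_ennreal)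
    then have "(c * I) / c = I" for I
      by (metis ennreal_mult_divide_eq mult.commute)
    moreover have "(\<integral>\<^sup>+y. h y * gauss (1 / Suc n) y \<partial>lborel)
        = c * (\<integral>\<^sup>+x. h x * gauss (1 / Suc n) x \<partial>subspace_lborel (\<xi>\<^sup>\<bottom>))"
      unfolding c_def by (rule nn_integral_subspace_gauss[OF \<xi> h]) (rule inv)
    ultimately show "(\<integral>\<^sup>+x. h x * gauss (1 / Suc n) x \<partial>subspace_lborel (\<xi>\<^sup>\<bottom>))
        = (\<integral>\<^sup>+y. h y * gauss (1 / Suc n) y \<partial>lborel) / gauss_mass (1 / Suc n) ^ dim \<xi>"
      unfolding c_def[symmetric] by simp
  qed
  finally show ?thesis .
qed

section \<open>Measurability on the space of cylinders\<close>

lemma infdist_le_hausdorff: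
  assumes K: "K \<in> convex_ring" and L: "L \<in> convex_ring"
  shows "infdist q L \<le> infdist q K + hausdorff_dist K L"
proof -
  note cK = convex_ring_compact[OF K] and cL = convex_ring_compact[OF L]
  obtain y where y: "y \<in> K" "infdist q K = dist q y"
    using infdist_attains_inf[of K q] cK compact_imp_closed by auto
  have "0 \<le> hausdorff_dist K L"
    by (simp add: hausdorff_dist_def)
  then have "infdist y L \<le> hausdorff_dist K L"
    using hausdorff_dist_le_iff[OF cK cL, of "hausdorff_dist K L"] y(1) by blast
  then show ?thesis
    using infdist_triangle[of q L y] y(2) by linarith
qed

lemma space_convex_ring_borel [simp]: "space (convex_ring_borel :: 'a::euclidean_space set measure) = convex_ring"
  and sets_convex_ring_borelI:
    "openin (Metric_space.mtopology convex_ring hausdorff_dist) U \<Longrightarrow>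
      U \<in> sets (convex_ring_borel :: 'a set measure)"
proof -
  interpret Metric_space "convex_ring :: 'a set set" hausdorff_dist
    by (rule Metric_space_convex_ring)
  have "{U. openin mtopology U} \<subseteq> Pow (convex_ring :: 'a set set)"
    using openin_subset by fastforce
  then show "space (convex_ring_borel :: 'a set measure) = convex_ring"
    "openin mtopology U \<Longrightarrow> U \<in> sets (convex_ring_borel :: 'a set measure)"
    by (auto simp: convex_ring_borel_def)
qed

text \<open>Together with a countable dense set of points \<open>q\<close>, these functions describe a set in the convex
  ring completely; all measurability statements about cylinders reduce to them.\<close>
lemma measurable_infdist_convex_ring [measurable]:
  fixes q :: "'a::euclidean_space"
  shows "infdist q \<in> borel_measurable convex_ring_borel"
proof -
  interpret Metric_space "convex_ring :: 'a set set" hausdorff_dist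
    by (rule Metric_space_convex_ring)
  show ?thesis
  proof (subst borel_measurable_iff_less, intro allI)
    fix a :: real
    have "openin mtopology {K \<in> convex_ring. infdist q K < a}"
      unfolding openin_mtopology
    proof safe
      fix K :: "'a set" assume K: "K \<in> convex_ring" "infdist q K < a"
      have "infdist q L < a" if "L \<in> mball K (a - infdist q K)" for L
        using infdist_le_hausdorff[OF K(1), of L q] that by (simp add: in_mball)
      then show "\<exists>r>0. mball K r \<subseteq> {K \<in> convex_ring. infdist q K < a}"
        using K by (intro exI[of _ "a - infdist q K"]) auto
    qed
    then show "{K \<in> space convex_ring_borel. infdist q K < a} \<in> sets convex_ring_borel"
      by (simp add: sets_convex_ring_borelI)
  qed
qed

lemma cylinderD:
  assumes "Z \<in> cylinders k"
  shows "subspace (direction Z)" "dim (direction Z) = k" "base Z \<in> convex_ring"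
    "base Z \<subseteq> (direction Z)\<^sup>\<bottom>" "Z = base Z + direction Z"
proof -
  obtain K \<xi> where *: "Z = K + \<xi>" "subspace \<xi>" "dim \<xi> = k" "K \<in> convex_ring" "K \<subseteq> \<xi>\<^sup>\<bottom>"
    using assms by (auto simp: cylinders_def grassmannian_def)
  then have "direction Z = \<xi>" "base Z = K"
    by (simp_all add: direction_eq base_eq)
  then show "subspace (direction Z)" "dim (direction Z) = k" "base Z \<in> convex_ring"
    "base Z \<subseteq> (direction Z)\<^sup>\<bottom>" "Z = base Z + direction Z"
    using * by simp_all
qed

lemma direction_ball_convex_ring:
  assumes "Z \<in> cylinders k"
  shows "direction Z \<inter> cball 0 1 \<in> convex_ring"
proof -
  note D = cylinderD(1)[OF assms]
  have "compact (direction Z \<inter> cball 0 1)"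
    using closed_Int_compact[OF closed_subspace[OF D] compact_cball] .
  moreover have "convex (direction Z \<inter> cball 0 1)"
    by (intro convex_Int subspace_imp_convex D convex_cball)
  moreover have "0 \<in> direction Z \<inter> cball 0 1"
    using subspace_0[OF D] by simp
  ultimately show ?thesis
    unfolding convex_ring_def by (intro CollectI exI[of _ "{direction Z \<inter> cball 0 1}"]) auto
qed

lemma space_cylinder_space [simp]: "space (cylinder_space k) = cylinders k"
  by (simp add: cylinder_space_def)

lemma measurable_direction_base:
  "(\<lambda>Z. (direction Z \<inter> cball 0 1, base Z)) \<in> cylinder_space k \<rightarrow>\<^sub>M convex_ring_borel \<Otimes>\<^sub>M convex_ring_borel"
  unfolding cylinder_space_def
  by (rule measurable_vimage_algebra1)
    (auto simp: space_pair_measure intro: direction_ball_convex_ring cylinderD(3))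

lemma measurable_direction [measurable]:
  "(\<lambda>Z. direction Z \<inter> cball 0 1) \<in> cylinder_space k \<rightarrow>\<^sub>M convex_ring_borel"
  using measurable_compose[OF measurable_direction_base measurable_fst] by simp

lemma measurable_base [measurable]: "base \<in> cylinder_space k \<rightarrow>\<^sub>M convex_ring_borel"
  using measurable_compose[OF measurable_direction_base measurable_snd] by simp

text \<open>The quantifiers over the uncountable sets \<open>K\<close> and \<open>D\<close> are replaced by quantifiers over a dense
  set.  An approximate hit for every tolerance forces an exact one, since the continuous distance
  to \<open>C\<close> attains its minimum on the compact set \<open>K \<times> D\<close>.\<close>
lemma compact_sum_hits_iff:
  fixes K D C S :: "'a::euclidean_space set" and m :: nat
  assumes K: "compact K" "K \<noteq> {}" and D: "compact D" "D \<noteq> {}" and C: "compact C" "C \<noteq> {}"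
    and S: "\<And>X. open X \<Longrightarrow> X \<noteq> {} \<Longrightarrow> \<exists>q\<in>S. q \<in> X"
  shows "(\<exists>\<kappa>\<in>K. \<exists>d\<in>D. y + \<kappa> + m *\<^sub>R d \<in> C) \<longleftrightarrow>
    (\<forall>n::nat. \<exists>q\<in>S. \<exists>q'\<in>S. infdist q K < 1 / Suc n \<and> infdist q' D < 1 / Suc n \<and>
       infdist (y + q + m *\<^sub>R q') C < 1 / Suc n)"
    (is "?L \<longleftrightarrow> ?R")
proof
  have S': "\<exists>q\<in>S. dist x q < \<delta>" if "0 < \<delta>" for x \<delta>
    using S[OF open_ball, of x \<delta>] that by (auto simp: mem_ball)
  have dist: "dist (y + a + m *\<^sub>R b) (y + a' + m *\<^sub>R b') \<le> dist a a' + m * dist b b'" for a b a' b'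
  proof -
    have "norm ((a - a') + m *\<^sub>R (b - b')) \<le> norm (a - a') + norm (m *\<^sub>R (b - b'))"
      by (rule norm_triangle_ineq)
    also have "norm (m *\<^sub>R (b - b')) = m * norm (b - b')"
      by simp
    finally show ?thesis
      by (simp only: dist_norm) (simp add: algebra_simps)
  qed
  {
    assume ?L
    then obtain \<kappa> d where kd: "\<kappa> \<in> K" "d \<in> D" "y + \<kappa> + m *\<^sub>R d \<in> C" by blast
    show ?R
    proof
      fix n :: nat
      \<comment> \<open>Errors of size \<open>e\<close> in both summands add up to \<open>(1 + m) e\<close>, as the second is scaled by \<open>m\<close>.\<close>
      define e where "e = 1 / Suc n / (m + 2)"
      have "0 < e" "(m + 2) * e = 1 / Suc n"
        by (simp_all add: e_def)
      moreover from this have "0 \<le> m * e"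
        by simp
      ultimately have e: "0 < e" "e \<le> 1 / Suc n" "(1 + m) * e < 1 / Suc n"
        by (simp_all only: distrib_right of_nat_add of_nat_numeral of_nat_1)
      obtain q q' where q: "q \<in> S" "dist \<kappa> q < e" "q' \<in> S" "dist d q' < e"
        using S'[OF e(1), of \<kappa>] S'[OF e(1), of d] by blast
      have "infdist q K < 1 / Suc n" "infdist q' D < 1 / Suc n"
        using infdist_le[OF kd(1), of q] infdist_le[OF kd(2), of q'] q e by (auto simp: dist_commute)
      moreover have "infdist (y + q + m *\<^sub>R q') C < 1 / Suc n"
      proof -
        have "infdist (y + q + m *\<^sub>R q') C \<le> dist q \<kappa> + m * dist q' d"
          using infdist_le[OF kd(3)] dist order_trans by blast
        also have "\<dots> \<le> e + m * e"
          using q by (intro add_mono mult_left_mono) (auto simp: dist_commute)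
        finally show ?thesis using e(3) by (simp add: algebra_simps)
      qed
      ultimately show "\<exists>q\<in>S. \<exists>q'\<in>S. infdist q K < 1 / Suc n \<and> infdist q' D < 1 / Suc n \<and>
          infdist (y + q + m *\<^sub>R q') C < 1 / Suc n"
        using q by blast
    qed
  next
    assume R: ?R
    define \<phi> where "\<phi> p = infdist (y + fst p + m *\<^sub>R snd p) C" for p
    have "continuous_on (K \<times> D) \<phi>"
      unfolding \<phi>_def by (intro continuous_intros)
    then obtain p where p: "p \<in> K \<times> D" "\<And>p'. p' \<in> K \<times> D \<Longrightarrow> \<phi> p \<le> \<phi> p'"
      using continuous_attains_inf[of "K \<times> D" \<phi>] K D compact_Times by blast
    have "\<phi> p = 0"
    proof (rule ccontr)
      assume "\<phi> p \<noteq> 0"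
      moreover have "0 \<le> \<phi> p"
        by (simp add: \<phi>_def infdist_nonneg)
      ultimately have "0 < \<phi> p / (m + 2)"
        by simp
      then obtain n where "inverse (real (Suc n)) < \<phi> p / (m + 2)"
        using reals_Archimedean by blast
      then have n: "(m + 2) * (1 / Suc n) < \<phi> p"
        by (simp add: field_simps)
      obtain q q' where q: "infdist q K < 1 / Suc n" "infdist q' D < 1 / Suc n"
        "infdist (y + q + m *\<^sub>R q') C < 1 / Suc n"
        using R by blast
      obtain \<kappa> where \<kappa>: "\<kappa> \<in> K" "infdist q K = dist q \<kappa>"
        using infdist_attains_inf[of K q] K compact_imp_closed by auto
      obtain d where d: "d \<in> D" "infdist q' D = dist q' d"
        using infdist_attains_inf[of D q'] D compact_imp_closed by auto
      have "\<phi> p \<le> infdist (y + \<kappa> + m *\<^sub>R d) C"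
        using p(2)[of "(\<kappa>, d)"] \<kappa> d by (simp add: \<phi>_def)
      also have "\<dots> \<le> infdist (y + q + m *\<^sub>R q') C + dist (y + \<kappa> + m *\<^sub>R d) (y + q + m *\<^sub>R q')"
        by (rule infdist_triangle)
      also have "\<dots> \<le> 1 / Suc n + (1 / Suc n + m * (1 / Suc n))"
        using q \<kappa> d dist[of \<kappa> d q q'] mult_left_mono[of "dist d q'" "1 / Suc n" "real m"]
        by (simp add: dist_commute)
      also have "\<dots> = (m + 2) * (1 / Suc n)"
        by (simp add: field_simps)
      finally show False using n by simp
    qed
    then have "y + fst p + m *\<^sub>R snd p \<in> C"
      using in_closed_iff_infdist_zero[of C] C compact_imp_closed by (auto simp: \<phi>_def)
    then show ?L
      using p(1) by (intro bexI[of _ "fst p"] bexI[of _ "snd p"]) auto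
  }
qed

text \<open>The direction space is exhausted by the multiples \<open>m D\<close> of its unit ball \<open>D\<close>, which is the
  compact set that the \<open>\<sigma>\<close>-algebra on cylinders refers to.\<close>
lemma translate_hits_iff:
  assumes Z: "Z \<in> cylinders k"
  shows "(+) y ` Z \<inter> C \<noteq> {} \<longleftrightarrow>
    (\<exists>m::nat. \<exists>\<kappa>\<in>base Z. \<exists>d\<in>direction Z \<inter> cball 0 1. y + \<kappa> + m *\<^sub>R d \<in> C)"
proof
  note D = cylinderD[OF Z]
  assume "(+) y ` Z \<inter> C \<noteq> {}"
  then obtain \<kappa> u where ku: "\<kappa> \<in> base Z" "u \<in> direction Z" "y + (\<kappa> + u) \<in> C"
    by (subst (asm) D(5)) (auto elim!: set_plus_elim)
  obtain m :: nat where m: "norm u < m"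
    using reals_Archimedean2 by blast
  then have m0: "0 < real m"
    by (rule le_less_trans[OF norm_ge_zero])
  then have "u = m *\<^sub>R ((1 / m) *\<^sub>R u)" "(1 / m) *\<^sub>R u \<in> direction Z \<inter> cball 0 1"
    using m ku(2) subspace_scale[OF D(1)] by (auto simp: field_simps)
  then show "\<exists>m::nat. \<exists>\<kappa>\<in>base Z. \<exists>d\<in>direction Z \<inter> cball 0 1. y + \<kappa> + m *\<^sub>R d \<in> C"
    using ku by (metis add.assoc)
next
  note D = cylinderD[OF Z]
  assume "\<exists>m::nat. \<exists>\<kappa>\<in>base Z. \<exists>d\<in>direction Z \<inter> cball 0 1. y + \<kappa> + m *\<^sub>R d \<in> C"
  then obtain m :: nat and \<kappa> d where *: "\<kappa> \<in> base Z" "d \<in> direction Z" "y + \<kappa> + m *\<^sub>R d \<in> C"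
    by blast
  then have "\<kappa> + m *\<^sub>R d \<in> Z"
    by (subst D(5)) (intro set_plus_intro subspace_scale[OF D(1)])
  then show "(+) y ` Z \<inter> C \<noteq> {}"
    using * by (auto simp: add.assoc)
qed

lemma pred_translate_hits:
  fixes C :: "'a::euclidean_space set"
  assumes C: "compact C" "C \<noteq> {}"
  shows "Measurable.pred (cylinder_space k \<Otimes>\<^sub>M borel) (\<lambda>p. (+) (snd p) ` fst p \<inter> C \<noteq> {})"
proof -
  obtain S :: "'a set" where S: "countable S" "\<And>X. open X \<Longrightarrow> X \<noteq> {} \<Longrightarrow> \<exists>q\<in>S. q \<in> X"
    by (rule countable_dense_setE) (rule that)
  have D: "(\<lambda>p::'a set \<times> 'a. infdist q (direction (fst p) \<inter> cball 0 1))
      \<in> borel_measurable (cylinder_space k \<Otimes>\<^sub>M borel)" for q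
    by (rule measurable_compose[OF measurable_compose[OF measurable_fst measurable_direction]
          measurable_infdist_convex_ring])
  have K: "(\<lambda>p::'a set \<times> 'a. infdist q (base (fst p)))
      \<in> borel_measurable (cylinder_space k \<Otimes>\<^sub>M borel)" for q
    by (rule measurable_compose[OF measurable_compose[OF measurable_fst measurable_base]
          measurable_infdist_convex_ring])
  have "(\<lambda>x. infdist (x + c) C) \<in> borel_measurable borel" for c
    by (intro borel_measurable_continuous_onI continuous_intros)
  then have I: "(\<lambda>p::'a set \<times> 'a. infdist (snd p + c) C)
      \<in> borel_measurable (cylinder_space k \<Otimes>\<^sub>M borel)" for c
    by (rule measurable_compose[OF measurable_snd])
  have "Measurable.pred (cylinder_space k \<Otimes>\<^sub>M borel)
    (\<lambda>p::'a set \<times> 'a. \<exists>m::nat. \<forall>n::nat. \<exists>q\<in>S. \<exists>q'\<in>S. infdist q (base (fst p)) < 1 / Suc n \<and>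
       infdist q' (direction (fst p) \<inter> cball 0 1) < 1 / Suc n \<and>
       infdist (snd p + q + m *\<^sub>R q') C < 1 / Suc n)"
    unfolding add.assoc
    by (intro pred_intros_countable measurable_pred_countable[OF S(1)] pred_intros_logic
        borel_measurable_pred_less D K I borel_measurable_const)
  also have "?this \<longleftrightarrow> ?thesis"
  proof (rule measurable_cong)
    fix p :: "'a set \<times> 'a" assume "p \<in> space (cylinder_space k \<Otimes>\<^sub>M borel)"
    then have Z: "fst p \<in> cylinders k" by (auto simp: space_pair_measure)
    show "(\<exists>m::nat. \<forall>n::nat. \<exists>q\<in>S. \<exists>q'\<in>S. infdist q (base (fst p)) < 1 / Suc n \<and>
       infdist q' (direction (fst p) \<inter> cball 0 1) < 1 / Suc n \<and>
       infdist (snd p + q + m *\<^sub>R q') C < 1 / Suc n) \<longleftrightarrow> (+) (snd p) ` fst p \<inter> C \<noteq> {}"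
      unfolding translate_hits_iff[OF Z]
      by (subst compact_sum_hits_iff[OF convex_ring_compact[OF cylinderD(3)[OF Z]]
            convex_ring_compact[OF direction_ball_convex_ring[OF Z]] C S(2)]) auto
  qed
  finally show ?thesis .
qed

lemma sets_hitting:
  fixes C :: "'a::euclidean_space set"
  assumes C: "compact C" "C \<noteq> {}"
  shows "hitting k C \<in> sets (cylinder_space k)"
proof -
  have "Measurable.pred (cylinder_space k) (\<lambda>Z. (+) (snd (Z, 0::'a)) ` fst (Z, 0::'a) \<inter> C \<noteq> {})"
    by (rule measurable_compose[OF _ pred_translate_hits[OF C]]) measurable
  then show ?thesis
    by (simp add: pred_def hitting_def)
qed

lemma closed_subset_if_infdist_eq:
  fixes A B :: "'a::metric_space set"
  assumes S: "\<And>X. open X \<Longrightarrow> X \<noteq> {} \<Longrightarrow> \<exists>q\<in>S. q \<in> X"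
    and B: "closed B" "B \<noteq> {}" and eq: "\<And>q. q \<in> S \<Longrightarrow> infdist q A = infdist q B"
  shows "A \<subseteq> B"
proof
  fix x assume x: "x \<in> A"
  show "x \<in> B"
  proof (rule ccontr)
    assume "x \<notin> B"
    then have "infdist x B \<noteq> 0"
      using in_closed_iff_infdist_zero[OF B] by blast
    then have "0 < infdist x B"
      using infdist_nonneg[of x B] by linarith
    then obtain q where q: "q \<in> S" "dist x q < infdist x B / 2"
      using S[OF open_ball, of x "infdist x B / 2"] by (auto simp: mem_ball)
    have "infdist x B \<le> infdist q B + dist x q"
      by (rule infdist_triangle)
    also have "infdist q B \<le> dist x q"
      using infdist_le[OF x, of q] eq[OF q(1)] by (simp add: dist_commute)
    finally show False using q(2) by simp
  qed
qed

lemma convex_ring_eq_if_infdist_eq: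
  assumes S: "\<And>X. open X \<Longrightarrow> X \<noteq> {} \<Longrightarrow> \<exists>q\<in>S. q \<in> X"
    and K: "K \<in> convex_ring" and L: "L \<in> convex_ring"
    and eq: "\<And>q. q \<in> S \<Longrightarrow> infdist q K = infdist q L"
  shows "K = L"
proof
  note K' = compact_imp_closed[OF convex_ring_compact(1)[OF K]] convex_ring_compact(2)[OF K]
    and L' = compact_imp_closed[OF convex_ring_compact(1)[OF L]] convex_ring_compact(2)[OF L]
  show "K \<subseteq> L"
    by (rule closed_subset_if_infdist_eq[OF S L']) (auto simp: eq)
  show "L \<subseteq> K"
    by (rule closed_subset_if_infdist_eq[OF S K']) (auto simp: eq)
qed

lemma subspace_subset_if_ball_subset:
  fixes V W :: "'a::real_normed_vector set"
  assumes "subspace V" "subspace W" "V \<inter> cball 0 1 \<subseteq> W"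
  shows "V \<subseteq> W"
proof
  fix x assume x: "x \<in> V"
  have "(1 / norm x) *\<^sub>R x \<in> V \<inter> cball 0 1"
    using x subspace_scale[OF assms(1)] by simp
  then have "norm x *\<^sub>R ((1 / norm x) *\<^sub>R x) \<in> W"
    using assms(3) subspace_scale[OF assms(2)] by blast
  then show "x \<in> W"
    using subspace_0[OF assms(2)] by (cases "x = 0") auto
qed

text \<open>Countably many distances determine direction space and base.  Measurable singletons make the
  atoms of a configuration visible to its counting measure.\<close>
lemma sets_singleton_cylinder:
  fixes Z :: "'a::euclidean_space set"
  assumes Z: "Z \<in> cylinders k"
  shows "{Z} \<in> sets (cylinder_space k)"
proof -
  obtain S :: "'a set" where S: "countable S" "\<And>X. open X \<Longrightarrow> X \<noteq> {} \<Longrightarrow> \<exists>q\<in>S. q \<in> X"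
    by (rule countable_dense_setE) (rule that)
  let ?P = "\<lambda>Z'. \<forall>q\<in>S. infdist q (direction Z' \<inter> cball 0 1) = infdist q (direction Z \<inter> cball 0 1) \<and>
    infdist q (base Z') = infdist q (base Z)"
  have "Z' = Z" if Z': "Z' \<in> cylinders k" and P: "?P Z'" for Z'
  proof -
    have "direction Z' \<inter> cball 0 1 = direction Z \<inter> cball 0 1"
      using P by (intro convex_ring_eq_if_infdist_eq[OF S(2)] direction_ball_convex_ring[OF Z]
          direction_ball_convex_ring[OF Z']) auto
    then have "direction Z' = direction Z"
      using subspace_subset_if_ball_subset[OF cylinderD(1)[OF Z] cylinderD(1)[OF Z']]
        subspace_subset_if_ball_subset[OF cylinderD(1)[OF Z'] cylinderD(1)[OF Z]] by blast
    moreover have "base Z' = base Z"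
      using P by (intro convex_ring_eq_if_infdist_eq[OF S(2)] cylinderD(3)[OF Z] cylinderD(3)[OF Z']) auto
    ultimately show ?thesis
      using cylinderD(5)[OF Z] cylinderD(5)[OF Z'] by simp
  qed
  then have "{Z} = {Z' \<in> space (cylinder_space k). ?P Z'}"
    using Z by auto
  also have "\<dots> \<in> sets (cylinder_space k)"
  proof -
    have "(\<lambda>Z. infdist q (direction Z \<inter> cball 0 1)) \<in> borel_measurable (cylinder_space k)" for q :: 'a
      by (rule measurable_compose[OF measurable_direction measurable_infdist_convex_ring])
    moreover have "(\<lambda>Z. infdist q (base Z)) \<in> borel_measurable (cylinder_space k)" for q :: 'a
      by (rule measurable_compose[OF measurable_base measurable_infdist_convex_ring])
    ultimately show ?thesis
      by (intro predE measurable_pred_countable[OF S(1)] pred_intros_logic pred_eq_const1[where N=borel])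
        simp_all
  qed
  finally show ?thesis .
qed

section \<open>Shifts that make a cylinder hit a set\<close>

lemma translate_convex_ring:
  assumes "K \<in> convex_ring"
  shows "(+) x ` K \<in> convex_ring"
proof -
  obtain F where F: "K = \<Union>F" "finite F" "F \<noteq> {}" "\<forall>C\<in>F. C \<noteq> {} \<and> compact C \<and> convex C"
    using assms by (auto simp: convex_ring_def)
  then show ?thesis
    unfolding convex_ring_def
    by (intro CollectI exI[of _ "(`) ((+) x) ` F"])
      (auto simp: image_Union intro!: compact_translation convex_translation)
qed

lemma translate_cylinder:
  assumes Z: "Z \<in> cylinders k" and x: "x \<in> (direction Z)\<^sup>\<bottom>"
  shows "(+) x ` Z \<in> cylinders k"
proof -
  note D = cylinderD[OF Z]
  have "(+) x ` (base Z + direction Z) = (+) x ` base Z + direction Z"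
    by (auto simp: set_plus_def image_iff add.assoc)
  then have "(+) x ` Z = (+) x ` base Z + direction Z"
    using D(5) by simp
  moreover have "(+) x ` base Z \<subseteq> (direction Z)\<^sup>\<bottom>"
    using D(4) x subspace_add[OF subspace_orthogonal_comp] by blast
  ultimately show ?thesis
    using D(1,2) translate_convex_ring[OF D(3)]
    unfolding cylinders_def grassmannian_def by blast
qed

lemma proj_along:
  assumes \<xi>: "subspace \<xi>"
  shows "proj_along \<xi> x \<in> \<xi>\<^sup>\<bottom>" "x - proj_along \<xi> x \<in> \<xi>"
    and proj_along_eqI: "y \<in> \<xi>\<^sup>\<bottom> \<Longrightarrow> x - y \<in> \<xi> \<Longrightarrow> proj_along \<xi> x = y"
proof -
  have uniq: "y = z" if "y \<in> \<xi>\<^sup>\<bottom>" "x - y \<in> \<xi>" "z \<in> \<xi>\<^sup>\<bottom>" "x - z \<in> \<xi>" for y z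
  proof -
    have "y - z \<in> \<xi>\<^sup>\<bottom>"
      using that by (intro subspace_diff subspace_orthogonal_comp)
    moreover have "y - z \<in> \<xi>"
      using subspace_diff[OF \<xi> that(4) that(2)] by simp
    ultimately have "(y - z) \<bullet> (y - z) = 0"
      by (auto simp: orthogonal_comp_def orthogonal_def)
    then show ?thesis by simp
  qed
  have "x \<in> \<xi> + \<xi>\<^sup>\<bottom>"
    using subspace_sum_orthogonal_comp[OF \<xi>] by simp
  then obtain u v where uv: "u \<in> \<xi>" "v \<in> \<xi>\<^sup>\<bottom>" "x = u + v"
    by (auto elim: set_plus_elim)
  have eq: "proj_along \<xi> x = y" if "y \<in> \<xi>\<^sup>\<bottom>" "x - y \<in> \<xi>" for y
    unfolding proj_along_def by (rule the_equality) (use that uniq in blast)+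
  then show "y \<in> \<xi>\<^sup>\<bottom> \<Longrightarrow> x - y \<in> \<xi> \<Longrightarrow> proj_along \<xi> x = y" .
  have "proj_along \<xi> x = v"
    using uv by (intro eq) auto
  then show "proj_along \<xi> x \<in> \<xi>\<^sup>\<bottom>" "x - proj_along \<xi> x \<in> \<xi>"
    using uv by auto
qed

text \<open>By \<open>hitting_shifts_eq\<close>, the shifts orthogonal to the direction space that move the cylinder
  onto \<open>C\<close>; the formula in the definition is how they appear in the contact distribution.\<close>
definition hitting_shifts :: "'a::euclidean_space set \<Rightarrow> 'a set \<Rightarrow> 'a set" where
  "hitting_shifts C Z = uminus ` base Z + proj_along (direction Z) ` C"

lemma hitting_shifts_eq:
  assumes Z: "Z \<in> cylinders k"
  shows "hitting_shifts C Z = {x \<in> (direction Z)\<^sup>\<bottom>. (+) x ` Z \<inter> C \<noteq> {}}"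
proof (rule set_eqI, rule iffI)
  note D = cylinderD[OF Z] and P = proj_along[OF cylinderD(1)[OF Z]]
  note sub = subspace_orthogonal_comp[of "direction Z"]
  fix x
  {
    assume "x \<in> hitting_shifts C Z"
    then obtain \<kappa> c where kc: "\<kappa> \<in> base Z" "c \<in> C" "x = - \<kappa> + proj_along (direction Z) c"
      by (auto simp: hitting_shifts_def elim!: set_plus_elim)
    have "x \<in> (direction Z)\<^sup>\<bottom>"
      unfolding kc(3) using kc(1) D(4) by (intro subspace_add[OF sub] subspace_neg[OF sub] P) auto
    moreover have "\<kappa> + (c - proj_along (direction Z) c) \<in> Z"
      using kc(1) P(2) by (subst D(5)) (rule set_plus_intro)
    then have "c \<in> (+) x ` Z"
      by (rule rev_image_eqI) (simp add: kc(3))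
    ultimately show "x \<in> {x \<in> (direction Z)\<^sup>\<bottom>. (+) x ` Z \<inter> C \<noteq> {}}"
      using kc(2) by blast
  next
    assume "x \<in> {x \<in> (direction Z)\<^sup>\<bottom>. (+) x ` Z \<inter> C \<noteq> {}}"
    then obtain z where x: "x \<in> (direction Z)\<^sup>\<bottom>" and z: "z \<in> Z" "x + z \<in> C"
      by blast
    obtain \<kappa> u where ku: "\<kappa> \<in> base Z" "u \<in> direction Z" "z = \<kappa> + u"
      using z(1) by (subst (asm) D(5)) (auto elim!: set_plus_elim)
    have "proj_along (direction Z) (x + z) = x + \<kappa>"
      using ku D(4) x by (intro P(3)) (auto intro: subspace_add[OF sub])
    then have "x = - \<kappa> + proj_along (direction Z) (x + z)"
      by simp
    then show "x \<in> hitting_shifts C Z"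
      unfolding hitting_shifts_def using ku(1) z(2) by (metis image_eqI set_plus_intro)
  }
qed

lemma sets_translate_hits:
  fixes C :: "'a::euclidean_space set"
  assumes C: "compact C" "C \<noteq> {}" and Z: "Z \<in> cylinders k"
  shows "{x. (+) x ` Z \<inter> C \<noteq> {}} \<in> sets borel"
proof -
  have "Measurable.pred borel (\<lambda>x. (+) (snd (Z, x)) ` fst (Z, x) \<inter> C \<noteq> {})"
    using Z by (intro measurable_compose[OF _ pred_translate_hits[OF C, of k]] measurable_Pair1') auto
  then show ?thesis
    by (simp add: pred_def)
qed

lemma emeasure_hitting_shifts:
  fixes C :: "'a::euclidean_space set"
  assumes C: "compact C" "C \<noteq> {}" and Z: "Z \<in> cylinders k"
  shows "emeasure (subspace_lborel ((direction Z)\<^sup>\<bottom>)) (hitting_shifts C Z)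
    = (\<integral>\<^sup>+x. indicator {x. (+) x ` Z \<inter> C \<noteq> {}} x \<partial>subspace_lborel ((direction Z)\<^sup>\<bottom>))"
proof -
  let ?V = "(direction Z)\<^sup>\<bottom>"
  have [measurable]: "{x. (+) x ` Z \<inter> C \<noteq> {}} \<in> sets borel"
    by (rule sets_translate_hits[OF C Z])
  have [measurable]: "?V \<in> sets borel"
    by (intro borel_closed closed_subspace subspace_orthogonal_comp)
  have "hitting_shifts C Z = {x. (+) x ` Z \<inter> C \<noteq> {}} \<inter> ?V"
    using hitting_shifts_eq[OF Z] by blast
  then have "emeasure (subspace_lborel ?V) (hitting_shifts C Z)
      = emeasure (subspace_lborel ?V) {x. (+) x ` Z \<inter> C \<noteq> {}}"
    using AE_subspace_lborel[OF subspace_orthogonal_comp[of "direction Z"]]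
    by (intro emeasure_eq_AE) auto
  then show ?thesis by simp
qed

lemma measurable_emeasure_hitting_shifts:
  fixes C :: "'a::euclidean_space set"
  assumes C: "compact C" "C \<noteq> {}"
  shows "(\<lambda>Z. emeasure (subspace_lborel ((direction Z)\<^sup>\<bottom>)) (hitting_shifts C Z))
    \<in> borel_measurable (cylinder_space k)"
proof -
  note [measurable] = pred_translate_hits[OF C, of k]
  have [measurable]: "(\<lambda>(Z, x). indicator {x. (+) x ` Z \<inter> C \<noteq> {}} x :: ennreal)
      \<in> borel_measurable (cylinder_space k \<Otimes>\<^sub>M borel)"
  proof -
    have "(\<lambda>p. if (+) (snd p) ` fst p \<inter> C \<noteq> {} then 1 else 0 :: ennreal)
        \<in> borel_measurable (cylinder_space k \<Otimes>\<^sub>M borel)"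
      by measurable
    also have "(\<lambda>p. if (+) (snd p) ` fst p \<inter> C \<noteq> {} then 1 else 0 :: ennreal)
        = (\<lambda>(Z, x). indicator {x. (+) x ` Z \<inter> C \<noteq> {}} x)"
      by (simp add: fun_eq_iff indicator_def)
    finally show ?thesis .
  qed
  have "(\<lambda>Z. SUP n::nat. (\<integral>\<^sup>+y. indicator {x. (+) x ` Z \<inter> C \<noteq> {}} y * gauss (1 / Suc n) y \<partial>lborel)
        / gauss_mass (1 / Suc n) ^ k) \<in> borel_measurable (cylinder_space k)"
    by measurable
  also have "?this \<longleftrightarrow> ?thesis"
  proof (rule measurable_cong)
    fix Z :: "'a set" assume "Z \<in> space (cylinder_space k)"
    then have Z: "Z \<in> cylinders k" by simp
    note D = cylinderD[OF Z]
    have inv: "indicator {x. (+) x ` Z \<inter> C \<noteq> {}} (x + u) = (indicator {x. (+) x ` Z \<inter> C \<noteq> {}} x :: ennreal)"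
      if u: "u \<in> direction Z" for x u
    proof -
      have "v + z \<in> Z" if "v \<in> direction Z" "z \<in> Z" for v z
      proof -
        obtain \<kappa> w where "\<kappa> \<in> base Z" "w \<in> direction Z" "z = \<kappa> + w"
          using \<open>z \<in> Z\<close> by (subst (asm) D(5)) (auto elim!: set_plus_elim)
        then show ?thesis
          using set_plus_intro[of \<kappa> "base Z" "v + w" "direction Z"] subspace_add[OF D(1)] that(1) D(5)
          by (simp add: algebra_simps)
      qed
      from this[OF u] this[OF subspace_neg[OF D(1) u]]
      have "(+) (x + u) ` Z = (+) x ` Z"
        by (force simp: image_iff algebra_simps intro: bexI[rotated])
      then show ?thesis by (simp add: indicator_def)
    qed
    have "(\<integral>\<^sup>+x. indicator {x. (+) x ` Z \<inter> C \<noteq> {}} x \<partial>subspace_lborel ((direction Z)\<^sup>\<bottom>))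
      = (SUP n::nat. (\<integral>\<^sup>+y. indicator {x. (+) x ` Z \<inter> C \<noteq> {}} y * gauss (1 / Suc n) y \<partial>lborel)
        / gauss_mass (1 / Suc n) ^ dim (direction Z))"
      using sets_translate_hits[OF C Z] by (intro nn_integral_subspace_eq_SUP D(1) inv) simp_all
    then show "(SUP n::nat. (\<integral>\<^sup>+y. indicator {x. (+) x ` Z \<inter> C \<noteq> {}} y * gauss (1 / Suc n) y \<partial>lborel)
        / gauss_mass (1 / Suc n) ^ k) = emeasure (subspace_lborel ((direction Z)\<^sup>\<bottom>)) (hitting_shifts C Z)"
      by (simp only: emeasure_hitting_shifts[OF C Z] D(2))
  qed
  finally show ?thesis .
qed

text \<open>The shape distribution is integrated against all shifts of the ambient space, but
  \<^const>\<open>subspace_lborel\<close> charges only those orthogonal to the direction space, for which the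
  shifted set is again a cylinder.\<close>
lemma emeasure_hitting:
  fixes C :: "'a::euclidean_space set"
  assumes C: "compact C" "C \<noteq> {}"
    and sets: "sets \<Lambda> = sets (cylinder_space k)" and I: "intensity_and_shape k \<Lambda> \<gamma> \<theta>"
  shows "emeasure \<Lambda> (hitting k C)
    = ennreal \<gamma> * (\<integral>\<^sup>+Z. emeasure (subspace_lborel ((direction Z)\<^sup>\<bottom>)) (hitting_shifts C Z) \<partial>\<theta>)"
proof -
  have h: "hitting k C \<in> sets (cylinder_space k)"
    by (rule sets_hitting[OF C])
  have sp: "space \<theta> \<subseteq> cylinders k"
    using I sets_eq_imp_space_eq[of \<theta> "restrict_space (cylinder_space k) (centred_cylinders k)"]
    by (auto simp: intensity_and_shape_def space_restrict_space)
  have "emeasure \<Lambda> (hitting k C) = (\<integral>\<^sup>+Z. indicator (hitting k C) Z \<partial>\<Lambda>)"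
    using h sets by simp
  also have "\<dots> = ennreal \<gamma> * (\<integral>\<^sup>+Z. (\<integral>\<^sup>+x. indicator (hitting k C) ((+) x ` Z)
      \<partial>subspace_lborel ((direction Z)\<^sup>\<bottom>)) \<partial>\<theta>)"
    using I h by (simp add: intensity_and_shape_def)
  also have "\<dots> = ennreal \<gamma> * (\<integral>\<^sup>+Z. emeasure (subspace_lborel ((direction Z)\<^sup>\<bottom>)) (hitting_shifts C Z) \<partial>\<theta>)"
  proof (intro arg_cong2[where f="(*)"] refl nn_integral_cong)
    fix Z assume "Z \<in> space \<theta>"
    then have Z: "Z \<in> cylinders k" using sp by blast
    show "(\<integral>\<^sup>+x. indicator (hitting k C) ((+) x ` Z) \<partial>subspace_lborel ((direction Z)\<^sup>\<bottom>))
        = emeasure (subspace_lborel ((direction Z)\<^sup>\<bottom>)) (hitting_shifts C Z)"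
      unfolding emeasure_hitting_shifts[OF C Z]
    proof (rule nn_integral_cong_AE,
        use AE_subspace_lborel[OF subspace_orthogonal_comp[of "direction Z"]] in eventually_elim)
      fix x assume "x \<in> (direction Z)\<^sup>\<bottom>"
      then show "indicator (hitting k C) ((+) x ` Z) = (indicator {x. (+) x ` Z \<inter> C \<noteq> {}} x :: ennreal)"
        using translate_cylinder[OF Z] by (simp add: hitting_def indicator_def)
    qed
  qed
  finally show ?thesis .
qed

section \<open>Void probabilities and the contact distribution\<close>

lemma space_configuration_space [simp]: "space (configuration_space k) = configurations k"
  unfolding configuration_space_def by (rule space_measure_of) blast

lemma measurable_count:
  assumes "A \<in> sets (cylinder_space k)"
  shows "(\<lambda>N. emeasure N A) \<in> borel_measurable (configuration_space k)"
proof (rule measurableI)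
  fix S :: "ennreal set" assume "S \<in> sets borel"
  then have "{N \<in> configurations k. emeasure N A \<in> S} \<in> sets (configuration_space k)"
    unfolding configuration_space_def using assms
    by (subst sets_measure_of) (auto intro!: sigma_sets.Basic)
  moreover have "(\<lambda>N. emeasure N A) -` S \<inter> space (configuration_space k)
      = {N \<in> configurations k. emeasure N A \<in> S}"
    by auto
  ultimately show "(\<lambda>N. emeasure N A) -` S \<inter> space (configuration_space k) \<in> sets (configuration_space k)"
    by simp
qed simp

text \<open>A counting measure vanishes on a set as soon as it has no atoms there; no such conclusion
  holds for diffuse measures.\<close>
lemma configuration_atom_iff:
  assumes N: "N \<in> configurations k" and A: "A \<in> sets (cylinder_space k)"
  shows "emeasure N A = 0 \<longleftrightarrow> (\<forall>Z\<in>A. emeasure N {Z} = 0)"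
proof -
  obtain m :: "'a set \<Rightarrow> nat" where m: "\<And>A. A \<in> sets (cylinder_space k) \<Longrightarrow>
      emeasure N A = (\<integral>\<^sup>+ Z. of_nat (m Z) \<partial>count_space A)"
    using N by (auto simp: configurations_def)
  have "emeasure N {Z} = of_nat (m Z)" if "Z \<in> A" for Z
    using that sets.sets_into_space[OF A] m[OF sets_singleton_cylinder[of Z k]]
    by (auto simp: nn_integral_count_space_finite)
  moreover have "emeasure N A = 0 \<longleftrightarrow> (\<forall>Z\<in>A. of_nat (m Z) = (0::ennreal))"
    unfolding m[OF A] by (subst nn_integral_0_iff_AE) (auto simp: AE_count_space)
  ultimately show ?thesis by simp
qed

lemma union_set_avoids_iff:
  fixes C :: "'a::euclidean_space set"
  assumes C: "compact C" "C \<noteq> {}" and N: "\<Xi> \<omega> \<in> configurations k"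
  shows "union_set \<Xi> \<omega> \<inter> C = {} \<longleftrightarrow> emeasure (\<Xi> \<omega>) (hitting k C) = 0"
proof -
  have cyl: "Z \<in> cylinders k" if "0 < emeasure (\<Xi> \<omega>) {Z}" for Z
  proof -
    have "{Z} \<in> sets (\<Xi> \<omega>)"
      using that emeasure_notin_sets by fastforce
    then show ?thesis
      using N sets.sets_into_space[of "{Z}" "cylinder_space k"] by (auto simp: configurations_def)
  qed
  have "union_set \<Xi> \<omega> \<inter> C = {} \<longleftrightarrow> (\<forall>Z\<in>hitting k C. emeasure (\<Xi> \<omega>) {Z} = 0)"
    using cyl by (fastforce simp: union_set_def hitting_def zero_less_iff_neq_zero)
  then show ?thesis
    by (simp add: configuration_atom_iff[OF N sets_hitting[OF C]])
qed

lemma void_probability: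
  fixes C :: "'a::euclidean_space set"
  assumes P: "poisson_cylinder_process k M \<Lambda> \<Xi>" and C: "compact C" "C \<noteq> {}"
  shows "{\<omega> \<in> space M. union_set \<Xi> \<omega> \<inter> C = {}} \<in> sets M"
    and "\<P>(\<omega> in M. union_set \<Xi> \<omega> \<inter> C = {}) = exp (- measure \<Lambda> (hitting k C))"
proof -
  note h = sets_hitting[OF C, of k]
  have \<Xi>: "\<Xi> \<in> M \<rightarrow>\<^sub>M configuration_space k"
    using P by (simp add: poisson_cylinder_process_def)
  have eq: "{\<omega> \<in> space M. union_set \<Xi> \<omega> \<inter> C = {}}
      = {\<omega> \<in> space M. emeasure (\<Xi> \<omega>) (hitting k C) = 0}"
    using union_set_avoids_iff[OF C, of \<Xi> _ k] measurable_space[OF \<Xi>]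
    by (intro Collect_cong conj_cong refl) simp
  have [measurable]: "(\<lambda>\<omega>. emeasure (\<Xi> \<omega>) (hitting k C)) \<in> borel_measurable M"
    by (rule measurable_compose[OF \<Xi> measurable_count[OF h]])
  show "{\<omega> \<in> space M. union_set \<Xi> \<omega> \<inter> C = {}} \<in> sets M"
    unfolding eq by measurable
  have "emeasure \<Lambda> (hitting k C) < \<infinity>"
    using P C by (simp add: poisson_cylinder_process_def locally_finite_def)
  moreover have "\<forall>A\<in>sets (cylinder_space k). emeasure \<Lambda> A < \<infinity> \<longrightarrow>
      (\<forall>n. \<P>(\<omega> in M. emeasure (\<Xi> \<omega>) A = of_nat n)
        = measure \<Lambda> A ^ n / fact n * exp (- measure \<Lambda> A))"
    using P unfolding poisson_cylinder_process_def by presburger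
  ultimately have "\<P>(\<omega> in M. emeasure (\<Xi> \<omega>) (hitting k C) = of_nat 0)
      = measure \<Lambda> (hitting k C) ^ 0 / fact 0 * exp (- measure \<Lambda> (hitting k C))"
    using h by blast
  then show "\<P>(\<omega> in M. union_set \<Xi> \<omega> \<inter> C = {}) = exp (- measure \<Lambda> (hitting k C))"
    unfolding eq by simp
qed

text \<open>Since \<open>0 \<in> r B\<close>, avoiding \<open>r B\<close> implies avoiding \<open>0\<close>, so the conditional probability is
  \<open>1 - P(U \<inter> r B = {}) / P(0 \<notin> U)\<close>, a quotient of two void probabilities.\<close>
lemma contact_distribution_eq:
  fixes B :: "'a::euclidean_space set"
  assumes P: "poisson_cylinder_process k M \<Lambda> \<Xi>" and B: "compact B" "0 \<in> B"
  shows "contact_distribution M \<Xi> B r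
    = 1 - exp (- (measure \<Lambda> (hitting k ((*\<^sub>R) r ` B)) - measure \<Lambda> (hitting k {0})))"
proof -
  interpret prob_space M
    using P by (simp add: poisson_cylinder_process_def)
  define C where "C = (*\<^sub>R) r ` B"
  have C: "compact C" "C \<noteq> {}" "0 \<in> C"
    using B compact_scaling[of B r] by (auto simp: C_def image_iff intro!: bexI[of _ 0])
  define E where "E D = {\<omega> \<in> space M. union_set \<Xi> \<omega> \<inter> D = {}}" for D
  note vC = void_probability[OF P C(1,2), folded E_def]
  have "compact {0::'a}" "{0::'a} \<noteq> {}" by auto
  note v0 = void_probability[OF P this, folded E_def]
  have "contact_distribution M \<Xi> B r = prob (E {0} - E C) / prob (E {0})"
    unfolding contact_distribution_def cond_prob_def C_def[symmetric] E_def
    by (intro arg_cong2[where f="(/)"] arg_cong[where f=prob]) auto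
  also have "prob (E {0} - E C) = prob (E {0}) - prob (E C)"
    using vC(1) v0(1) C(3) by (intro finite_measure_Diff) (auto simp: E_def)
  also have "(prob (E {0}) - prob (E C)) / prob (E {0}) = 1 - prob (E C) / prob (E {0})"
    by (simp only: v0(2) diff_divide_distrib) simp
  also have "\<dots> = 1 - exp (- (measure \<Lambda> (hitting k C) - measure \<Lambda> (hitting k {0})))"
    by (simp add: vC(2) v0(2) flip: exp_diff)
  finally show ?thesis
    by (simp add: C_def)
qed

text \<open>Finiteness of the integral over \<open>\<theta>\<close> comes from local finiteness of \<open>\<Lambda>\<close>; dividing by \<open>\<gamma>\<close>
  requires \<open>\<gamma> > 0\<close>.\<close>
lemma shape_integral:
  fixes C :: "'a::euclidean_space set"
  assumes C: "compact C" "C \<noteq> {}" and P: "poisson_cylinder_process k M \<Lambda> \<Xi>"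
    and I: "intensity_and_shape k \<Lambda> \<gamma> \<theta>" and \<gamma>: "0 < \<gamma>"
  shows "integrable \<theta> (\<lambda>Z. measure (subspace_lborel ((direction Z)\<^sup>\<bottom>)) (hitting_shifts C Z))"
    and "\<gamma> * (\<integral>Z. measure (subspace_lborel ((direction Z)\<^sup>\<bottom>)) (hitting_shifts C Z) \<partial>\<theta>)
      = measure \<Lambda> (hitting k C)"
proof -
  define g where "g Z = emeasure (subspace_lborel ((direction Z)\<^sup>\<bottom>)) (hitting_shifts C Z)" for Z
  have mg: "measure (subspace_lborel ((direction Z)\<^sup>\<bottom>)) (hitting_shifts C Z) = enn2real (g Z)" for Z
    by (simp add: g_def measure_def)
  have \<Lambda>: "sets \<Lambda> = sets (cylinder_space k)" "emeasure \<Lambda> (hitting k C) < \<infinity>"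
    using P C by (auto simp: poisson_cylinder_process_def locally_finite_def)
  have eq: "emeasure \<Lambda> (hitting k C) = ennreal \<gamma> * (\<integral>\<^sup>+Z. g Z \<partial>\<theta>)"
    unfolding g_def by (rule emeasure_hitting[OF C \<Lambda>(1) I])
  have [measurable]: "g \<in> borel_measurable \<theta>"
  proof -
    have "g \<in> borel_measurable (restrict_space (cylinder_space k) (centred_cylinders k))"
      unfolding g_def
      by (intro measurable_restrict_space1 measurable_emeasure_hitting_shifts[OF C])
    then show ?thesis
      using I by (subst measurable_cong_sets[of \<theta> _ borel borel]) (auto simp: intensity_and_shape_def)
  qed
  have fin: "(\<integral>\<^sup>+Z. g Z \<partial>\<theta>) < \<infinity>"
    using \<Lambda>(2) \<gamma> unfolding eq by (auto simp: ennreal_mult_less_top)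
  then have "AE Z in \<theta>. g Z \<noteq> \<infinity>"
    by (intro nn_integral_PInf_AE) auto
  then have "(\<integral>\<^sup>+Z. ennreal (enn2real (g Z)) \<partial>\<theta>) = (\<integral>\<^sup>+Z. g Z \<partial>\<theta>)"
    by (intro nn_integral_cong_AE) (auto elim!: eventually_mono simp: less_top)
  note nn = this
  show "integrable \<theta> (\<lambda>Z. measure (subspace_lborel ((direction Z)\<^sup>\<bottom>)) (hitting_shifts C Z))"
    unfolding mg using fin nn by (intro integrableI_nonneg) auto
  have "(\<integral>Z. enn2real (g Z) \<partial>\<theta>) = enn2real (\<integral>\<^sup>+Z. g Z \<partial>\<theta>)"
    by (subst integral_eq_nn_integral) (auto simp: nn)
  then show "\<gamma> * (\<integral>Z. measure (subspace_lborel ((direction Z)\<^sup>\<bottom>)) (hitting_shifts C Z) \<partial>\<theta>)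
      = measure \<Lambda> (hitting k C)"
    using \<gamma> unfolding mg by (simp add: measure_def eq enn2real_mult)
qed

lemma measure_hitting_shifts_origin:
  fixes Z :: "'a::euclidean_space set"
  assumes Z: "Z \<in> cylinders k"
  shows "measure (subspace_lborel ((direction Z)\<^sup>\<bottom>)) (hitting_shifts {0} Z) = cross_section_volume Z"
proof -
  note D = cylinderD[OF Z]
  have "proj_along (direction Z) 0 = 0"
    using subspace_0[OF D(1)] subspace_0[OF subspace_orthogonal_comp] by (intro proj_along_eqI D) auto
  then have "hitting_shifts {0} Z = uminus ` base Z"
    by (auto simp: hitting_shifts_def set_plus_def)
  moreover have "base Z \<in> sets borel"
    by (intro borel_compact convex_ring_compact D)
  ultimately show ?thesis
    by (simp add: cross_section_volume_def measure_def
        emeasure_subspace_lborel_uminus[OF subspace_orthogonal_comp])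
qed

theorem mainTheorem5:
  fixes M :: "'w measure"
    and \<Xi> :: "'w \<Rightarrow> 'a::euclidean_space set measure"
    and \<Lambda> \<theta> :: "'a set measure"
    and B :: "'a set"
    and k :: nat and \<gamma> r :: real
  assumes "k < DIM('a)"
    and "poisson_cylinder_process k M \<Lambda> \<Xi>"
    and "simple_process M \<Xi>"
    and "stationary_process k M \<Xi>"
    and "intensity_and_shape k \<Lambda> \<gamma> \<theta>"
    and "0 < volume_fraction M \<Xi>" and "volume_fraction M \<Xi> < 1"
    and "compact B" and "0 \<in> B"
    and "0 < r"
  shows "integrable \<theta> (\<lambda>Z.
           measure (subspace_lborel ((direction Z)\<^sup>\<bottom>))
             (uminus ` base Z + proj_along (direction Z) ` ((*\<^sub>R) r ` B))
           - cross_section_volume Z)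
       \<and> contact_distribution M \<Xi> B r =
         1 - exp (- \<gamma> * (\<integral>Z.
           measure (subspace_lborel ((direction Z)\<^sup>\<bottom>))
             (uminus ` base Z + proj_along (direction Z) ` ((*\<^sub>R) r ` B))
           - cross_section_volume Z \<partial>\<theta>))"
proof -
  note P = \<open>poisson_cylinder_process k M \<Lambda> \<Xi>\<close> and I = \<open>intensity_and_shape k \<Lambda> \<gamma> \<theta>\<close>
  interpret prob_space M
    using P by (simp add: poisson_cylinder_process_def)
  define C where "C = (*\<^sub>R) r ` B"
  have C: "compact C" "C \<noteq> {}"
    using \<open>compact B\<close> \<open>0 \<in> B\<close> compact_scaling[of B r] by (auto simp: C_def)
  have O: "compact {0::'a}" "{0::'a} \<noteq> {}" by auto
  \<comment> \<open>A vanishing intensity would make \<open>U\<close> almost surely avoid the origin, against \<open>p > 0\<close>.\<close>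
  have "\<gamma> \<noteq> 0"
  proof
    assume "\<gamma> = 0"
    have "sets \<Lambda> = sets (cylinder_space k)"
      using P by (simp add: poisson_cylinder_process_def)
    then have "measure \<Lambda> (hitting k {0}) = 0"
      using emeasure_hitting[OF O _ I] \<open>\<gamma> = 0\<close> by (simp add: measure_def)
    then have "prob {\<omega> \<in> space M. union_set \<Xi> \<omega> \<inter> {0} = {}} = 1"
      using void_probability(2)[OF P O] by simp
    then have "AE \<omega> in M. union_set \<Xi> \<omega> \<inter> {0} = {}"
      using void_probability(1)[OF P O] by (subst (asm) prob_Collect_eq_1) auto
    then have "volume_fraction M \<Xi> = 0"
      unfolding volume_fraction_def by (intro prob_eq_0_AE) auto
    then show False
      using \<open>0 < volume_fraction M \<Xi>\<close> by simp
  qed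
  then have \<gamma>: "0 < \<gamma>"
    using I by (simp add: intensity_and_shape_def)
  note iC = shape_integral[OF C P I \<gamma>] and i0 = shape_integral[OF O P I \<gamma>]
  have "space \<theta> \<subseteq> cylinders k"
    using I sets_eq_imp_space_eq[of \<theta> "restrict_space (cylinder_space k) (centred_cylinders k)"]
    by (auto simp: intensity_and_shape_def space_restrict_space)
  then have A: "measure (subspace_lborel ((direction Z)\<^sup>\<bottom>)) (hitting_shifts {0} Z) = cross_section_volume Z"
    if "Z \<in> space \<theta>" for Z
    using that measure_hitting_shifts_origin by blast
  have i0': "integrable \<theta> cross_section_volume"
    using i0(1) Bochner_Integration.integrable_cong[OF refl A, of \<theta>] by simp
  have I0: "\<gamma> * (\<integral>Z. cross_section_volume Z \<partial>\<theta>) = measure \<Lambda> (hitting k {0})"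
    using i0(2) Bochner_Integration.integral_cong[OF refl A, of \<theta>] by simp
  have "contact_distribution M \<Xi> B r = 1 - exp (- \<gamma> * (\<integral>Z.
      measure (subspace_lborel ((direction Z)\<^sup>\<bottom>)) (hitting_shifts C Z) - cross_section_volume Z \<partial>\<theta>))"
    using iC i0' I0 unfolding contact_distribution_eq[OF P \<open>compact B\<close> \<open>0 \<in> B\<close>] C_def[symmetric]
    by (simp add: right_diff_distrib)
  then show ?thesis
    using Bochner_Integration.integrable_diff[OF iC(1) i0'] by (simp add: hitting_shifts_def C_def)
qed

end
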